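(* Assume the diffusion condition, the cost conditions and the following condition: if $y_*>a$, then $c_1\in C^1(\mathcal R)$, $c_1(\cdot,z_* )\in C^2(\mathcal I)$ and the function $AG+c_0$ is decreasing on $(a,y_* )$. Then $G$ is in $C^1(\mathcal I)\cap C^2(\mathcal I\setminus\{y_*\})$ and satisfies $$\begin{cases}AG(x)+c_0(x)-F_*\ge 0, & \text{for all }x\in\mathcal I\setminus\{y_*\},\\ BG(y,z)\ge -c_1(y,z), & \text{for all }(y,z)\in\mathcal R,\\ AG(x)+c_0(x)-F_*=0, & \text{for all }x>y_*,\\ BG(x,z_* )=-c_1(x,z_* ), & \text{for all }x\le y_*.\end{cases}$$
   Context: Diffusion. Let $\mathcal I=(a,b)$ with $-\infty\le a<b\le\infty$, let $\mu,\sigma$ be continuous on $\mathcal I$ with $\sigma^2>0$, and consider the regular diffusion $dX_0(t)=\mu(X_0(t))\,dt+\sigma(X_0(t))\,dW(t)$ on $\mathcal I$, $X_0(0)=x_0\in\mathcal I$, $W$ a standard Brownian motion, with generator $Af(x)=\frac{\sigma^2(x)}2f''(x)+\mu(x)f'(x)$. Scale density $s(x)=\exp(-\int^x 2\mu(v)/\sigma^2(v)\,dv)$, scale function $S(x)=\int^x s(v)\,dv$, scale measure $S[y,z]=S(z)-S(y)$, speed density $m(x)=1/(\sigma^2(x)s(x))$, speed measure $M[y,z]=\int_y^z m(v)\,dv$; half-open versions such as $S(a,x]$, $M[y,b)$ are limits. Diffusion condition: $a$ is attracting ($S(a,x]<\infty$) and $b$ is non-attracting ($S[x,b)=\infty$)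 for $x\in\mathcal I$. Boundary classification: $a$ is attainable if $\int_a^x M[u,x]\,dS(u)<\infty$ (then regular if $M(a,x]<\infty$ and exit if $M(a,x]=\infty$), and natural otherwise; $b$ is entrance if $\int_y^b M[u,b)\,dS(u)<\infty$, and natural otherwise. If $a$ is regular its boundary behavior is specified as reflective or sticky. If $a=-\infty$ or $b=\infty$, that boundary is required to be natural. $\mathcal E$ is $\mathcal I$ together with $a$ if $a$ is attainable and together with $b$ if $b$ is entrance. $\mathcal R=\{(y,z)\in\mathcal E^2:y<z\}$, $\overline{\mathcal R}=\{(y,z)\in\mathcal E^2:y\le z\}$. Cost conditions: (a) $c_0:\mathcal I\to\mathbb R^+$ is continuous and inf-compact ($\{x\in\mathcal I:c_0(x)\le L\}$ is compact for every $L>0$); if $a\in\mathcal E$ then $\lim_{x\to a}c_0(x)=\infty$, and if $b\in\mathcal E$ then $\lim_{x\to b}c_0(x)=\infty$; for each $y\in\mathcal I$, $\int_y^b c_0\,dM<\infty$ and $\int_y^b\int_u^b c_0(v)\,dM(v)\,dS(u)=\infty$. (b) $c_1:\overline{\mathcal R}\to\mathbb R^+$ is continuous with $c_1\ge k_1$ for a constant $k_1>0$; $c_1(y,z)\ge c_1(z,z)$ for $y\le z$ in $\mathcal I$; and $c_1(w,z)+c_1(x,y)=c_1(w,y)+c_1(x,z)$ for $w\le x\le y\le z$ in $\mathcal I$. Functions. Fix $C\in\mathcal I$. On $\mathcal E$ set $g_0(x)=\int_C^x\int_u^b 2c_0(v)\,dM(v)\,dS(u)$ and $\zeta(x)=2\int_C^x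 M[u,b)\,dS(u)$. For $(y,z)\in\mathcal R$ and a function $f$, $Bf(y,z)=f(z)-f(y)$, and $F(y,z)=\frac{c_1(y,z)+Bg_0(y,z)}{B\zeta(y,z)}$. Under the diffusion and cost conditions $F$ attains its infimum; $F_*=\inf_{\mathcal R}F$ and $(y_*,z_* )\in\mathcal R$ is a pair with $F(y_*,z_* )=F_*$. Define $$G(x)=\begin{cases}c_1(x,z_* )+g_0(z_* )-F_*\zeta(z_* ), & x\le y_*,\\ g_0(x)-F_*\zeta(x), & x>y_*,\end{cases}$$ for $x\in\mathcal I$ (and by the same formula at boundary points belonging to $\mathcal E$). Regularity of $c_1(\cdot,z_* )$ is understood on its domain $\{x\in\mathcal I: x\le z_*\}$. *)

theory Defs
  imports "HOL-Analysis.Analysis"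
begin

text \<open>
  The \<open>base_point\<close> is the arbitrary lower limit of the indefinite integrals \<open>\<integral>\<^sup>x\<close>
  defining the scale density and the scale function.
\<close>

record diffusion =
  left_end :: ereal
  right_end :: ereal
  drift :: "real \<Rightarrow> real"
  volatility :: "real \<Rightarrow> real"
  base_point :: real

definition state_interval :: "diffusion \<Rightarrow> real set" where
  "state_interval X = einterval (left_end X) (right_end X)"

definition diffusion_coefficients :: "diffusion \<Rightarrow> bool" where
  "diffusion_coefficients X \<longleftrightarrow>
     left_end X < right_end X \<and> base_point X \<in> state_interval X \<and>
     continuous_on (state_interval X) (drift X) \<and>
     continuous_on (state_interval X) (volatility X) \<and>
     (\<forall>x\<in>state_interval X. (volatility X x)\<^sup>2 > 0)"

definition generator :: "diffusion \<Rightarrow> (real \<Rightarrow> real) \<Rightarrow> real \<Rightarrow> real" where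
  "generator X f x = (volatility X x)\<^sup>2 / 2 * deriv (deriv f) x + drift X x * deriv f x"

definition scale_density :: "diffusion \<Rightarrow> real \<Rightarrow> real" where
  "scale_density X x =
     exp (- (LBINT v=ereal (base_point X)..ereal x. 2 * drift X v / (volatility X v)\<^sup>2))"

definition scale_function :: "diffusion \<Rightarrow> real \<Rightarrow> real" where
  "scale_function X x = (LBINT v=ereal (base_point X)..ereal x. scale_density X v)"

definition speed_density :: "diffusion \<Rightarrow> real \<Rightarrow> real" where
  "speed_density X x = 1 / ((volatility X x)\<^sup>2 * scale_density X x)"

text \<open>
  Both measures live on the whole real line but are concentrated on the open state interval.
  Hence, with \<open>a\<close>, \<open>b\<close> the end points, the sets \<open>{..x}\<close> and \<open>{x..}\<close> below stand for
  \<open>(a, x]\<close> and \<open>[x, b)\<close>, and integrals over them for \<open>\<integral>\<^sub>a\<^sup>x\<close> and \<open>\<integral>\<^sub>x\<^sup>b\<close>.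
\<close>

definition scale_meas :: "diffusion \<Rightarrow> real measure" where
  "scale_meas X =
     density lborel (\<lambda>x. indicator (state_interval X) x * ennreal (scale_density X x))"

definition speed_meas :: "diffusion \<Rightarrow> real measure" where
  "speed_meas X =
     density lborel (\<lambda>x. indicator (state_interval X) x * ennreal (speed_density X x))"

text \<open>
  On compact intervals the two measures are given by the increments of the scale function and
  by the integrals of the speed density.
\<close>

lemma Icc_subset_state_interval:
  "y \<in> state_interval X \<Longrightarrow> z \<in> state_interval X \<Longrightarrow> {y..z} \<subseteq> state_interval X"
proof
  fix x assume "y \<in> state_interval X" "z \<in> state_interval X" "x \<in> {y..z}"
  then have "left_end X < ereal y" "ereal y \<le> ereal x" "ereal x \<le> ereal z" "ereal z < right_end X"
    by (simp_all add: state_interval_def einterval_iff)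
  then show "x \<in> state_interval X"
    unfolding state_interval_def einterval_iff using less_le_trans le_less_trans by blast
qed

lemma continuous_on_state_interval_LBINT:
  fixes f :: "real \<Rightarrow> real"
  assumes "continuous_on (state_interval X) f" and p: "p \<in> state_interval X"
  shows "continuous_on (state_interval X) (\<lambda>x. LBINT v=ereal p..ereal x. f v)"
proof (rule continuous_at_imp_continuous_on, rule ballI)
  fix x assume x: "x \<in> state_interval X"
  have op: "open (state_interval X)"
    by (simp add: state_interval_def)
  have "min p x \<in> state_interval X" "max p x \<in> state_interval X"
    using p x by (auto simp: min_def max_def)
  then obtain e1 e2 where e: "e1 > 0" "cball (min p x) e1 \<subseteq> state_interval X"
      "e2 > 0" "cball (max p x) e2 \<subseteq> state_interval X"
    using op by (meson open_contains_cball)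
  define l u where "l = min p x - e1" and "u = max p x + e2"
  have "l \<in> cball (min p x) e1" "u \<in> cball (max p x) e2"
    using e by (auto simp: l_def u_def dist_real_def)
  then have "l \<in> state_interval X" "u \<in> state_interval X"
    using e by auto
  then have "continuous_on {l..u} f"
    using assms(1) Icc_subset_state_interval continuous_on_subset by blast
  moreover have lu: "l \<le> p" "p \<le> u" "l < x" "x < u"
    using e by (auto simp: l_def u_def)
  ultimately have "((\<lambda>x. LBINT v=ereal p..ereal x. f v) has_vector_derivative f x)
      (at x within {l..u})"
    by (intro interval_integral_FTC2) auto
  then show "isCont (\<lambda>x. LBINT v=ereal p..ereal x. f v) x"
    using lu by (auto dest: has_vector_derivative_continuous simp: at_within_Icc_at)
qed

lemma continuous_on_densities:
  assumes "diffusion_coefficients X"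
  shows "continuous_on (state_interval X) (scale_density X)"
    and "continuous_on (state_interval X) (speed_density X)"
proof -
  have "continuous_on (state_interval X) (\<lambda>v. 2 * drift X v / (volatility X v)\<^sup>2)"
    using assms unfolding diffusion_coefficients_def by (intro continuous_intros) auto
  then show 1: "continuous_on (state_interval X) (scale_density X)"
    unfolding scale_density_def using assms
    by (intro continuous_intros continuous_on_state_interval_LBINT)
       (auto simp: diffusion_coefficients_def)
  show "continuous_on (state_interval X) (speed_density X)"
    unfolding speed_density_def using assms
    by (intro continuous_intros 1) (auto simp: diffusion_coefficients_def scale_density_def)
qed

lemma emeasure_density_Icc:
  assumes c: "continuous_on (state_interval X) f"
    and nonneg: "\<And>x. 0 \<le> f x"
    and yz: "y \<in> state_interval X" "z \<in> state_interval X" "y \<le> z"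
  shows "emeasure (density lborel (\<lambda>x. indicator (state_interval X) x * ennreal (f x))) {y..z} =
    ennreal (LBINT v=ereal y..ereal z. f v)"
proof -
  note sub = Icc_subset_state_interval[OF yz(1,2)]
  have "(\<lambda>x. indicator (state_interval X) x *\<^sub>R f x) \<in> borel_measurable borel"
    by (rule borel_measurable_continuous_on_indicator[OF _ c]) (simp add: state_interval_def)
  then have "(\<lambda>x. ennreal (indicator (state_interval X) x *\<^sub>R f x)) \<in> borel_measurable borel"
    by measurable
  also have "(\<lambda>x. ennreal (indicator (state_interval X) x *\<^sub>R f x)) =
      (\<lambda>x. indicator (state_interval X) x * ennreal (f x))"
    by (auto simp: indicator_def)
  finally have "emeasure (density lborel (\<lambda>x. indicator (state_interval X) x * ennreal (f x))) {y..z}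
      = (\<integral>\<^sup>+x. indicator (state_interval X) x * ennreal (f x) * indicator {y..z} x \<partial>lborel)"
    by (subst emeasure_density) auto
  also have "\<dots> = (\<integral>\<^sup>+x. ennreal (indicator {y..z} x *\<^sub>R f x) \<partial>lborel)"
    using sub by (intro nn_integral_cong) (auto simp: indicator_def)
  also have "\<dots> = ennreal (LINT x|lborel. indicator {y..z} x *\<^sub>R f x)"
  proof (rule nn_integral_eq_integral)
    show "integrable lborel (\<lambda>x. indicator {y..z} x *\<^sub>R f x)"
      using borel_integrable_atLeastAtMost'[OF continuous_on_subset[OF c sub]]
      by (simp add: set_integrable_def)
  qed (auto simp: nonneg)
  also have "(LINT x|lborel. indicator {y..z} x *\<^sub>R f x) = (LBINT v=ereal y..ereal z. f v)"
    using yz by (simp add: interval_integral_Icc set_lebesgue_integral_def)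
  finally show ?thesis .
qed

lemma emeasure_speed_meas_Icc:
  assumes "diffusion_coefficients X" "y \<in> state_interval X" "z \<in> state_interval X" "y \<le> z"
  shows "emeasure (speed_meas X) {y..z} = ennreal (LBINT v=ereal y..ereal z. speed_density X v)"
  unfolding speed_meas_def using assms
  by (intro emeasure_density_Icc continuous_on_densities)
     (auto simp: speed_density_def scale_density_def)

lemma emeasure_scale_meas_Icc:
  assumes X: "diffusion_coefficients X" and yz: "y \<in> state_interval X" "z \<in> state_interval X" "y \<le> z"
  shows "emeasure (scale_meas X) {y..z} = ennreal (scale_function X z - scale_function X y)"
proof -
  define p l u where "p = base_point X" and "l = min p y" and "u = max p z"
  have "l \<in> state_interval X" "u \<in> state_interval X"
    using X yz by (simp_all add: p_def l_def u_def min_def max_def diffusion_coefficients_def)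
  then have "continuous_on {l..u} (scale_density X)"
    using continuous_on_subset[OF continuous_on_densities(1)[OF X] Icc_subset_state_interval]
    by simp
  then have "set_integrable lborel {l..u} (scale_density X)"
    by (rule borel_integrable_atLeastAtMost')
  then have "set_integrable lborel (einterval (ereal l) (ereal u)) (scale_density X)"
    by (rule set_integrable_subset) (auto simp: einterval_iff)
  moreover have "l \<le> u"
    by (simp add: l_def u_def min_le_iff_disj le_max_iff_disj)
  ultimately have "interval_lebesgue_integrable lborel (ereal l) (ereal u) (scale_density X)"
    by (simp add: interval_lebesgue_integrable_def)
  moreover have "ereal l = min (ereal p) (min (ereal y) (ereal z))"
      "ereal u = max (ereal p) (max (ereal y) (ereal z))"
    using yz(3) by (simp_all add: l_def u_def min_def max_def)
  ultimately have "(LBINT v=ereal p..ereal y. scale_density X v) +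
      (LBINT v=ereal y..ereal z. scale_density X v) = (LBINT v=ereal p..ereal z. scale_density X v)"
    by (intro interval_integral_sum) simp
  then have "(LBINT v=ereal y..ereal z. scale_density X v) = scale_function X z - scale_function X y"
    by (simp add: scale_function_def p_def)
  moreover have "emeasure (scale_meas X) {y..z} = ennreal (LBINT v=ereal y..ereal z. scale_density X v)"
    unfolding scale_meas_def using assms
    by (intro emeasure_density_Icc continuous_on_densities) (auto simp: scale_density_def)
  ultimately show ?thesis
    by simp
qed

definition left_attracting :: "diffusion \<Rightarrow> bool" where
  "left_attracting X \<longleftrightarrow> (\<forall>x\<in>state_interval X. emeasure (scale_meas X) {..x} < \<infinity>)"

definition right_non_attracting :: "diffusion \<Rightarrow> bool" where
  "right_non_attracting X \<longleftrightarrow> (\<forall>x\<in>state_interval X. emeasure (scale_meas X) {x..} = \<infinity>)"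

definition left_attainable :: "diffusion \<Rightarrow> bool" where
  "left_attainable X \<longleftrightarrow>
     (\<forall>x\<in>state_interval X.
        (\<integral>\<^sup>+u\<in>{..x}. emeasure (speed_meas X) {u..x} \<partial>scale_meas X) < \<infinity>)"

definition right_entrance :: "diffusion \<Rightarrow> bool" where
  "right_entrance X \<longleftrightarrow>
     (\<forall>y\<in>state_interval X.
        (\<integral>\<^sup>+u\<in>{y..}. emeasure (speed_meas X) {u..} \<partial>scale_meas X) < \<infinity>)"

text \<open>
  Under the attraction hypotheses a boundary point is natural precisely when it is not
  attainable (left) or not an entrance boundary (right).
\<close>

definition diffusion_condition :: "diffusion \<Rightarrow> bool" where
  "diffusion_condition X \<longleftrightarrow>
     left_attracting X \<and> right_non_attracting X \<and>
     (left_end X = -\<infinity> \<longrightarrow> \<not> left_attainable X) \<and>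
     (right_end X = \<infinity> \<longrightarrow> \<not> right_entrance X)"

text \<open>An infinite end point is natural, so the extended state space consists of real numbers.\<close>

definition state_space :: "diffusion \<Rightarrow> real set" where
  "state_space X =
     state_interval X \<union> {x. ereal x = left_end X \<and> left_attainable X}
                      \<union> {x. ereal x = right_end X \<and> right_entrance X}"

definition order_pairs :: "diffusion \<Rightarrow> (real \<times> real) set" where
  "order_pairs X = {(y, z). y \<in> state_space X \<and> z \<in> state_space X \<and> y < z}"

definition weak_order_pairs :: "diffusion \<Rightarrow> (real \<times> real) set" where
  "weak_order_pairs X = {(y, z). y \<in> state_space X \<and> z \<in> state_space X \<and> y \<le> z}"

definition holding_cost_condition :: "diffusion \<Rightarrow> (real \<Rightarrow> real) \<Rightarrow> bool" where
  "holding_cost_condition X c0 \<longleftrightarrow>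
     (\<forall>x\<in>state_interval X. 0 \<le> c0 x) \<and>
     continuous_on (state_interval X) c0 \<and>
     (\<forall>L>0. compact {x\<in>state_interval X. c0 x \<le> L}) \<and>
     (\<forall>x\<in>state_space X. ereal x = left_end X \<longrightarrow> filterlim c0 at_top (at_right x)) \<and>
     (\<forall>x\<in>state_space X. ereal x = right_end X \<longrightarrow> filterlim c0 at_top (at_left x)) \<and>
     (\<forall>y\<in>state_interval X.
        (\<integral>\<^sup>+v\<in>{y..}. ennreal (c0 v) \<partial>speed_meas X) < \<infinity> \<and>
        (\<integral>\<^sup>+u\<in>{y..}. (\<integral>\<^sup>+v\<in>{u..}. ennreal (c0 v) \<partial>speed_meas X) \<partial>scale_meas X) = \<infinity>)"

definition ordering_cost_condition :: "diffusion \<Rightarrow> (real \<times> real \<Rightarrow> real) \<Rightarrow> bool" where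
  "ordering_cost_condition X c1 \<longleftrightarrow>
     continuous_on (weak_order_pairs X) c1 \<and>
     (\<exists>k1>0. \<forall>p\<in>weak_order_pairs X. k1 \<le> c1 p) \<and>
     (\<forall>y\<in>state_interval X. \<forall>z\<in>state_interval X. y \<le> z \<longrightarrow> c1 (z, z) \<le> c1 (y, z)) \<and>
     (\<forall>w\<in>state_interval X. \<forall>x\<in>state_interval X. \<forall>y\<in>state_interval X. \<forall>z\<in>state_interval X.
        w \<le> x \<and> x \<le> y \<and> y \<le> z \<longrightarrow> c1 (w, z) + c1 (x, y) = c1 (w, y) + c1 (x, z))"

definition oriented_scale_integral ::
    "diffusion \<Rightarrow> real \<Rightarrow> real \<Rightarrow> (real \<Rightarrow> ennreal) \<Rightarrow> ereal" where
  "oriented_scale_integral X C x f =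
     (if C \<le> x then enn2ereal (\<integral>\<^sup>+u\<in>{C..x}. f u \<partial>scale_meas X)
      else - enn2ereal (\<integral>\<^sup>+u\<in>{x..C}. f u \<partial>scale_meas X))"

text \<open>
  The functions are extended-real valued because \<open>g\<^sub>0\<close> may be infinite at an end point that
  belongs to the state space: it is \<open>\<infinity>\<close> on the right, and possibly \<open>-\<infinity>\<close> on the left. No
  indeterminate form \<open>\<infinity> - \<infinity>\<close> arises from this in the increments taken below.
\<close>

definition g0 :: "diffusion \<Rightarrow> (real \<Rightarrow> real) \<Rightarrow> real \<Rightarrow> real \<Rightarrow> ereal" where
  "g0 X c0 C x =
     oriented_scale_integral X C x (\<lambda>u. \<integral>\<^sup>+v\<in>{u..}. ennreal (2 * c0 v) \<partial>speed_meas X)"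

definition zeta :: "diffusion \<Rightarrow> real \<Rightarrow> real \<Rightarrow> ereal" where
  "zeta X C x = 2 * oriented_scale_integral X C x (\<lambda>u. emeasure (speed_meas X) {u..})"

definition jump_op :: "(real \<Rightarrow> ereal) \<Rightarrow> real \<times> real \<Rightarrow> ereal" where
  "jump_op f = (\<lambda>(y, z). f z - f y)"

definition cost_ratio ::
    "diffusion \<Rightarrow> (real \<Rightarrow> real) \<Rightarrow> (real \<times> real \<Rightarrow> real) \<Rightarrow> real \<Rightarrow> real \<times> real \<Rightarrow> ereal" where
  "cost_ratio X c0 c1 C p =
     (ereal (c1 p) + jump_op (g0 X c0 C) p) / jump_op (zeta X C) p"

definition optimal_cost ::
    "diffusion \<Rightarrow> (real \<Rightarrow> real) \<Rightarrow> (real \<times> real \<Rightarrow> real) \<Rightarrow> real \<Rightarrow> ereal" where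
  "optimal_cost X c0 c1 C = (INF p\<in>order_pairs X. cost_ratio X c0 c1 C p)"

definition G_fun ::
    "diffusion \<Rightarrow> (real \<Rightarrow> real) \<Rightarrow> (real \<times> real \<Rightarrow> real) \<Rightarrow> real \<Rightarrow> real \<times> real \<Rightarrow> real \<Rightarrow> ereal"
  where
  "G_fun X c0 c1 C = (\<lambda>(ys, zs) x.
     if x \<le> ys
     then ereal (c1 (x, zs)) + g0 X c0 C zs - optimal_cost X c0 c1 C * zeta X C zs
     else g0 X c0 C x - optimal_cost X c0 c1 C * zeta X C x)"

text \<open>
  The domains need not be open: derivatives are taken within the domain, hence are
  one-sided at its boundary points.
\<close>

definition C1_on :: "'a::real_normed_vector set \<Rightarrow> ('a \<Rightarrow> real) \<Rightarrow> bool" where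
  "C1_on D f \<longleftrightarrow>
     (\<exists>f' :: 'a \<Rightarrow> 'a \<Rightarrow>\<^sub>L real.
        (\<forall>x\<in>D. (f has_derivative blinfun_apply (f' x)) (at x within D)) \<and> continuous_on D f')"

definition C2_on :: "real set \<Rightarrow> (real \<Rightarrow> real) \<Rightarrow> bool" where
  "C2_on D f \<longleftrightarrow>
     (\<exists>f'. (\<forall>x\<in>D. (f has_real_derivative f' x) (at x within D)) \<and> C1_on D f')"

end

theory Submission
  imports Defs
begin

text \<open>
  Write \<open>h = g\<^sub>0 - F\<^sub>* \<zeta>\<close>. On the interior, \<open>A h + c\<^sub>0 = F\<^sub>*\<close>, and optimality of
  \<open>(y\<^sub>*, z\<^sub>*)\<close> says that \<open>c\<^sub>1(y, z) + h(z) - h(y) \<ge> 0\<close> with equality at \<open>(y\<^sub>*, z\<^sub>*)\<close>.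
  If \<open>y\<^sub>* > a\<close>, the first-order condition for \<open>c\<^sub>1(\<cdot>, z\<^sub>*) - h\<close> at \<open>y\<^sub>*\<close> makes the two pieces
  of \<open>G\<close> fit together smoothly, and the second-order condition gives \<open>A G + c\<^sub>0 \<ge> F\<^sub>*\<close> in the limit
  from the left at \<open>y\<^sub>*\<close>; monotonicity extends this to \<open>(a, y\<^sub>*)\<close>. The inequality for \<open>B G\<close> across
  \<open>y\<^sub>*\<close> follows from optimality by the modularity identity for \<open>c\<^sub>1\<close>, which transfers \<open>c\<^sub>1(y\<^sub>*, \<cdot>)\<close>
  to \<open>c\<^sub>1(y, \<cdot>)\<close>.
\<close>

section \<open>Calculus of the scale density on the open state interval\<close>

lemma open_state_interval: "open (state_interval X)"
  by (simp add: state_interval_def)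

lemma LBINT_has_real_derivative:
  fixes f :: "real \<Rightarrow> real"
  assumes "continuous_on (state_interval X) f"
    and p: "p \<in> state_interval X" and x: "x \<in> state_interval X"
  shows "((\<lambda>x. LBINT v=ereal p..ereal x. f v) has_real_derivative f x) (at x)"
proof -
  have "min p x \<in> state_interval X" "max p x \<in> state_interval X"
    using p x by (auto simp: min_def max_def)
  then obtain e1 e2 where e: "e1 > 0" "cball (min p x) e1 \<subseteq> state_interval X"
      "e2 > 0" "cball (max p x) e2 \<subseteq> state_interval X"
    using open_state_interval by (meson open_contains_cball)
  \<comment> \<open>The compact interval from \<open>l\<close> to \<open>u\<close> contains
    \<open>p\<close> and has \<open>x\<close> in its interior, so the derivative that the
    fundamental theorem yields within it is two-sided at \<open>x\<close>.\<close>
  define l u where "l = min p x - e1" and "u = max p x + e2"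
  have "l \<in> cball (min p x) e1" "u \<in> cball (max p x) e2"
    using e by (auto simp: l_def u_def dist_real_def)
  then have "l \<in> state_interval X" "u \<in> state_interval X"
    using e by auto
  then have "continuous_on {l..u} f"
    using assms(1) Icc_subset_state_interval continuous_on_subset by blast
  moreover have lu: "l \<le> p" "p \<le> u" "l < x" "x < u"
    using e by (auto simp: l_def u_def)
  ultimately have "((\<lambda>x. LBINT v=ereal p..ereal x. f v) has_vector_derivative f x)
      (at x within {l..u})"
    by (intro interval_integral_FTC2) auto
  then show ?thesis
    using lu by (simp add: at_within_Icc_at has_real_derivative_iff_has_vector_derivative)
qed

lemma scale_density_has_real_derivative:
  assumes X: "diffusion_coefficients X" and x: "x \<in> state_interval X"
  shows "(scale_density X has_real_derivative
    - (2 * drift X x / (volatility X x)\<^sup>2) * scale_density X x) (at x)"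
proof -
  have "continuous_on (state_interval X) (\<lambda>v. 2 * drift X v / (volatility X v)\<^sup>2)"
    using X unfolding diffusion_coefficients_def by (intro continuous_intros) auto
  moreover have "base_point X \<in> state_interval X"
    using X by (simp add: diffusion_coefficients_def)
  ultimately show ?thesis
    unfolding scale_density_def[abs_def]
    by (auto intro!: derivative_eq_intros LBINT_has_real_derivative x)
qed

lemma scale_density_pos: "0 < scale_density X x"
  by (simp add: scale_density_def)

lemma speed_density_nonneg: "0 \<le> speed_density X x"
  by (simp add: speed_density_def scale_density_def)

section \<open>Integrals against the scale and speed measures as Lebesgue integrals\<close>

lemma borel_measurable_state_interval_indicator:
  fixes f :: "real \<Rightarrow> real"
  assumes "continuous_on (state_interval X) f"
  shows "(\<lambda>x. ennreal (indicator (state_interval X) x *\<^sub>R f x)) \<in> borel_measurable borel"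
proof -
  have "(\<lambda>x. indicator (state_interval X) x *\<^sub>R f x) \<in> borel_measurable borel"
    by (rule borel_measurable_continuous_on_indicator[OF _ assms]) (simp add: open_state_interval)
  then show ?thesis
    by measurable
qed

lemma borel_measurable_state_interval_density:
  fixes f :: "real \<Rightarrow> real"
  assumes "continuous_on (state_interval X) f"
  shows "(\<lambda>x. indicator (state_interval X) x * ennreal (f x)) \<in> borel_measurable borel"
proof -
  have "(\<lambda>x. ennreal (indicator (state_interval X) x *\<^sub>R f x)) =
      (\<lambda>x. indicator (state_interval X) x * ennreal (f x))"
    by (auto simp: indicator_def)
  then show ?thesis
    using borel_measurable_state_interval_indicator[OF assms] by simp
qed

lemma AE_state_interval_density:
  fixes f :: "real \<Rightarrow> real"
  assumes "continuous_on (state_interval X) f"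
  shows "AE x in density lborel (\<lambda>x. indicator (state_interval X) x * ennreal (f x)).
    x \<in> state_interval X"
  using borel_measurable_state_interval_density[OF assms]
  by (subst AE_density) (auto simp: indicator_def)

text \<open>Measurability of \<open>k\<close> is known only on the state interval. The measure
  ignores the complement, so \<open>k\<close> may first be truncated to the interval, which makes it
  Borel on the whole line, and the density formula then applies.\<close>

lemma nn_integral_state_interval_density:
  fixes f k :: "real \<Rightarrow> real"
  assumes f: "continuous_on (state_interval X) f" and nonneg: "\<And>x. 0 \<le> f x"
    and k: "continuous_on (state_interval X) k"
    and A: "A \<in> sets borel"
  shows "(\<integral>\<^sup>+v\<in>A. ennreal (k v)
      \<partial>density lborel (\<lambda>x. indicator (state_interval X) x * ennreal (f x))) =
    (\<integral>\<^sup>+v\<in>A. indicator (state_interval X) v * ennreal (k v * f v) \<partial>lborel)"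
proof -
  let ?M = "density lborel (\<lambda>x. indicator (state_interval X) x * ennreal (f x))"
  have "(\<integral>\<^sup>+v\<in>A. ennreal (k v) \<partial>?M) =
      (\<integral>\<^sup>+v\<in>A. indicator (state_interval X) v * ennreal (k v) \<partial>?M)"
    using AE_state_interval_density[OF f] by (intro nn_integral_cong_AE) (auto simp: indicator_def)
  also have "\<dots> = (\<integral>\<^sup>+v. indicator (state_interval X) v * ennreal (f v) *
      (indicator (state_interval X) v * ennreal (k v) * indicator A v) \<partial>lborel)"
    using borel_measurable_state_interval_density[OF f] borel_measurable_state_interval_density[OF k] A
    by (intro nn_integral_density) auto
  also have "\<dots> = (\<integral>\<^sup>+v\<in>A. indicator (state_interval X) v * ennreal (k v * f v) \<partial>lborel)"
    using nonneg by (intro nn_integral_cong) (auto simp: indicator_def ennreal_mult' mult_ac)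
  finally show ?thesis .
qed

lemma nn_integral_state_interval_Icc:
  fixes q :: "real \<Rightarrow> real"
  assumes q: "continuous_on (state_interval X) q" and nonneg: "\<And>x. x \<in> state_interval X \<Longrightarrow> 0 \<le> q x"
    and yz: "y \<in> state_interval X" "z \<in> state_interval X" "y \<le> z"
  shows "(\<integral>\<^sup>+v\<in>{y..z}. indicator (state_interval X) v * ennreal (q v) \<partial>lborel) =
      ennreal (LBINT v=ereal y..ereal z. q v)"
    and "0 \<le> (LBINT v=ereal y..ereal z. q v)"
proof -
  note sub = Icc_subset_state_interval[OF yz(1,2)]
  have nn: "0 \<le> indicator {y..z} x *\<^sub>R q x" for x
    using nonneg sub by (auto simp: indicator_def)
  have eq: "(LINT x|lborel. indicator {y..z} x *\<^sub>R q x) = (LBINT v=ereal y..ereal z. q v)"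
    using yz by (simp add: interval_integral_Icc set_lebesgue_integral_def)
  show "0 \<le> (LBINT v=ereal y..ereal z. q v)"
    using nn by (simp add: eq[symmetric] Bochner_Integration.integral_nonneg)
  have "(\<integral>\<^sup>+v\<in>{y..z}. indicator (state_interval X) v * ennreal (q v) \<partial>lborel) =
      (\<integral>\<^sup>+x. ennreal (indicator {y..z} x *\<^sub>R q x) \<partial>lborel)"
    using sub by (intro nn_integral_cong) (auto simp: indicator_def)
  also have "\<dots> = ennreal (LINT x|lborel. indicator {y..z} x *\<^sub>R q x)"
  proof (rule nn_integral_eq_integral)
    show "integrable lborel (\<lambda>x. indicator {y..z} x *\<^sub>R q x)"
      using borel_integrable_atLeastAtMost'[OF continuous_on_subset[OF q sub]]
      by (simp add: set_integrable_def)
  qed (use nn in simp)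
  finally show "(\<integral>\<^sup>+v\<in>{y..z}. indicator (state_interval X) v * ennreal (q v) \<partial>lborel) =
      ennreal (LBINT v=ereal y..ereal z. q v)"
    by (simp only: eq)
qed

section \<open>Tail integrals and the potentials built from them\<close>

lemma nn_integral_atLeast_split:
  fixes f :: "real \<Rightarrow> ennreal"
  assumes f: "f \<in> borel_measurable borel" and yz: "y \<le> z"
  shows "(\<integral>\<^sup>+v\<in>{y..}. f v \<partial>lborel) = (\<integral>\<^sup>+v\<in>{y..z}. f v \<partial>lborel) + (\<integral>\<^sup>+v\<in>{z..}. f v \<partial>lborel)"
proof -
  have "(\<integral>\<^sup>+v\<in>{y..z}. f v \<partial>lborel) + (\<integral>\<^sup>+v\<in>{z..}. f v \<partial>lborel) =
      (\<integral>\<^sup>+v. f v * indicator {y..z} v + f v * indicator {z..} v \<partial>lborel)"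
    using f by (intro nn_integral_add[symmetric]) auto
  also have "\<dots> = (\<integral>\<^sup>+v\<in>{y..}. f v \<partial>lborel)"
    \<comment> \<open>The two ranges share the point \<open>z\<close>, which is a null set.\<close>
    using AE_lborel_singleton[of z] yz
    by (intro nn_integral_cong_AE) (auto simp: indicator_def)
  finally show ?thesis by simp
qed

text \<open>Finiteness at one point \<open>p\<close> spreads to every \<open>u\<close>, since two
  tails differ by the integral of a continuous function over a compact interval. The tail is thus a
  constant minus an oriented integral started at \<open>p\<close>, which the fundamental theorem
  differentiates.\<close>

lemma tail_integral_differentiable:
  fixes q :: "real \<Rightarrow> real"
  assumes q: "continuous_on (state_interval X) q" and nonneg: "\<And>x. x \<in> state_interval X \<Longrightarrow> 0 \<le> q x"
    and p: "p \<in> state_interval X"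
    and fin: "(\<integral>\<^sup>+v\<in>{p..}. indicator (state_interval X) v * ennreal (q v) \<partial>lborel) < \<infinity>"
  obtains \<phi> where
    "\<And>u. u \<in> state_interval X \<Longrightarrow>
      (\<integral>\<^sup>+v\<in>{u..}. indicator (state_interval X) v * ennreal (q v) \<partial>lborel) = ennreal (\<phi> u)"
    "\<And>u. u \<in> state_interval X \<Longrightarrow> 0 \<le> \<phi> u"
    "\<And>u. u \<in> state_interval X \<Longrightarrow> (\<phi> has_real_derivative - q u) (at u)"
proof -
  define T where "T u = (\<integral>\<^sup>+v\<in>{u..}. indicator (state_interval X) v * ennreal (q v) \<partial>lborel)" for u
  define \<phi> where "\<phi> u = enn2real (T p) - (LBINT v=ereal p..ereal u. q v)" for u
  have split: "T y = ennreal (LBINT v=ereal y..ereal z. q v) + T z"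
      "0 \<le> (LBINT v=ereal y..ereal z. q v)"
    if "y \<in> state_interval X" "z \<in> state_interval X" "y \<le> z" for y z
    unfolding T_def
    using nn_integral_atLeast_split[OF borel_measurable_state_interval_density[OF q] that(3)]
      nn_integral_state_interval_Icc[OF q nonneg that]
    by simp_all
  have p_eq: "T p = ennreal (enn2real (T p))"
    using fin by (simp add: T_def)
  have T: "T u = ennreal (\<phi> u) \<and> 0 \<le> \<phi> u" if u: "u \<in> state_interval X" for u
  proof (cases "u \<le> p")
    case True
    have "(LBINT v=ereal p..ereal u. q v) = - (LBINT v=ereal u..ereal p. q v)"
      by (rule interval_integral_endpoints_reverse)
    then show ?thesis
      using split[OF u p True] p_eq by (simp add: \<phi>_def ennreal_plus[symmetric] add.commute del: ennreal_plus)
        (metis ennreal_plus enn2real_nonneg add.commute)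
  next
    case False
    then have s: "T p = ennreal (LBINT v=ereal p..ereal u. q v) + T u"
      "0 \<le> (LBINT v=ereal p..ereal u. q v)"
      using split[OF p u] by auto
    \<comment> \<open>Finiteness at \<open>p\<close> excludes an infinite tail at \<open>u\<close>,
      so the splitting can be read as an equation of reals.\<close>
    then have "T u < \<infinity>"
      using fin unfolding T_def[symmetric] by (auto simp: less_top)
    then obtain t where t: "T u = ennreal t" "0 \<le> t"
      by (metis enn2real_nonneg ennreal_enn2real infinity_ennreal_def)
    with s have "enn2real (T p) = (LBINT v=ereal p..ereal u. q v) + t"
      by (simp add: ennreal_plus[symmetric] del: ennreal_plus)
    with t show ?thesis
      by (simp add: \<phi>_def)
  qed
  show thesis
  proof
    fix u assume u: "u \<in> state_interval X"
    show "(\<integral>\<^sup>+v\<in>{u..}. indicator (state_interval X) v * ennreal (q v) \<partial>lborel) = ennreal (\<phi> u)"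
      "0 \<le> \<phi> u"
      using T[OF u] by (simp_all add: T_def)
    show "(\<phi> has_real_derivative - q u) (at u)"
      unfolding \<phi>_def[abs_def]
      by (auto intro!: derivative_eq_intros LBINT_has_real_derivative q p u)
  qed
qed

text \<open>The sign chosen in \<open>oriented_scale_integral\<close> for \<open>x < C\<close> is
  the orientation of the interval integral, so one formula serves both sides of \<open>C\<close>.
  Integration runs only over compact parts of the interval, where \<open>f\<close> is given by the
  real function \<open>\<phi>\<close>.\<close>

lemma oriented_scale_integral_eq_LBINT:
  assumes X: "diffusion_coefficients X" and C: "C \<in> state_interval X" and x: "x \<in> state_interval X"
    and \<phi>: "continuous_on (state_interval X) \<phi>" "\<And>u. u \<in> state_interval X \<Longrightarrow> 0 \<le> \<phi> u"
    and f: "\<And>u. u \<in> state_interval X \<Longrightarrow> f u = ennreal (\<phi> u)"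
  shows "oriented_scale_integral X C x f =
    ereal (LBINT u=ereal C..ereal x. \<phi> u * scale_density X u)"
proof -
  note s = continuous_on_densities(1)[OF X]
  have c: "continuous_on (state_interval X) (\<lambda>u. \<phi> u * scale_density X u)"
    by (intro continuous_intros \<phi> s)
  have pos: "0 \<le> \<phi> u * scale_density X u" if "u \<in> state_interval X" for u
    using \<phi>(2)[OF that] scale_density_pos[of X u] by simp
  have *: "enn2ereal (\<integral>\<^sup>+u\<in>{y..z}. f u \<partial>scale_meas X) =
      ereal (LBINT u=ereal y..ereal z. \<phi> u * scale_density X u)"
    if yz: "y \<in> state_interval X" "z \<in> state_interval X" "y \<le> z" for y z
  proof -
    have "(\<integral>\<^sup>+u\<in>{y..z}. f u \<partial>scale_meas X) = (\<integral>\<^sup>+u\<in>{y..z}. ennreal (\<phi> u) \<partial>scale_meas X)"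
      using Icc_subset_state_interval[OF yz(1,2)] f
      by (intro nn_integral_cong) (auto simp: indicator_def)
    also have "\<dots> =
        (\<integral>\<^sup>+v\<in>{y..z}. indicator (state_interval X) v * ennreal (\<phi> v * scale_density X v) \<partial>lborel)"
      unfolding scale_meas_def
      by (intro nn_integral_state_interval_density s \<phi>(1) less_imp_le[OF scale_density_pos]) auto
    also have "\<dots> = ennreal (LBINT u=ereal y..ereal z. \<phi> u * scale_density X u)"
      by (intro nn_integral_state_interval_Icc(1) c pos yz)
    finally show ?thesis
      using nn_integral_state_interval_Icc(2)[OF c pos yz] by (simp add: enn2ereal_ennreal)
  qed
  show ?thesis
  proof (cases "C \<le> x")
    case True
    then show ?thesis
      by (simp add: oriented_scale_integral_def * C x)
  next
    case False
    then show ?thesis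
      using interval_integral_endpoints_reverse[of "ereal C" "ereal x" "\<lambda>u. \<phi> u * scale_density X u"]
      by (simp add: oriented_scale_integral_def * C x)
  qed
qed


text \<open>Here \<open>\<gamma>\<close> is the tail of \<open>k dM\<close> times the scale density
  \<open>s\<close>. The product rule with \<open>s' = - 2 mu s / sigma^2\<close> and
  \<open>m s = 1 / sigma^2\<close> gives \<open>A \<Gamma> = - k / 2\<close>. Taking
  \<open>k = 2 c0\<close> yields \<open>g0\<close>, and \<open>k = 1\<close> yields half of
  \<open>zeta\<close>.\<close>

lemma second_order_primitive:
  assumes X: "diffusion_coefficients X" and C: "C \<in> state_interval X"
    and k: "continuous_on (state_interval X) k" "\<And>x. x \<in> state_interval X \<Longrightarrow> 0 \<le> k x"
    and fin: "(\<integral>\<^sup>+v\<in>{C..}. ennreal (k v) \<partial>speed_meas X) < \<infinity>"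
  obtains \<Gamma> \<gamma> where
    "\<And>x. x \<in> state_interval X \<Longrightarrow>
      oriented_scale_integral X C x (\<lambda>u. \<integral>\<^sup>+v\<in>{u..}. ennreal (k v) \<partial>speed_meas X) = ereal (\<Gamma> x)"
    "\<And>x. x \<in> state_interval X \<Longrightarrow> (\<Gamma> has_real_derivative \<gamma> x) (at x)"
    "\<And>x. x \<in> state_interval X \<Longrightarrow>
      (\<gamma> has_real_derivative (- k x - 2 * drift X x * \<gamma> x) / (volatility X x)\<^sup>2) (at x)"
    "\<And>x. x \<in> state_interval X \<Longrightarrow> 0 \<le> \<gamma> x"
    "\<And>x. x \<in> state_interval X \<Longrightarrow> (\<And>v. v \<in> state_interval X \<Longrightarrow> 0 < k v) \<Longrightarrow> 0 < \<gamma> x"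
proof -
  define q where "q v = k v * speed_density X v" for v
  note dens = continuous_on_densities[OF X]
  have q: "continuous_on (state_interval X) q"
    unfolding q_def[abs_def] by (intro continuous_intros k dens)
  have q0: "0 \<le> q x" if "x \<in> state_interval X" for x
    using k(2)[OF that] by (simp add: q_def speed_density_nonneg)
  have tail: "(\<integral>\<^sup>+v\<in>{u..}. ennreal (k v) \<partial>speed_meas X) =
      (\<integral>\<^sup>+v\<in>{u..}. indicator (state_interval X) v * ennreal (q v) \<partial>lborel)" for u
    unfolding speed_meas_def q_def
    by (intro nn_integral_state_interval_density dens k speed_density_nonneg) auto
  obtain \<phi> where \<phi>:
      "\<And>u. u \<in> state_interval X \<Longrightarrow>
        (\<integral>\<^sup>+v\<in>{u..}. indicator (state_interval X) v * ennreal (q v) \<partial>lborel) = ennreal (\<phi> u)"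
      "\<And>u. u \<in> state_interval X \<Longrightarrow> 0 \<le> \<phi> u"
      "\<And>u. u \<in> state_interval X \<Longrightarrow> (\<phi> has_real_derivative - q u) (at u)"
    by (rule tail_integral_differentiable[OF q q0 C]) (use fin in \<open>auto simp: tail\<close>)
  have c\<phi>: "continuous_on (state_interval X) \<phi>"
    using \<phi>(3) by (meson DERIV_isCont continuous_at_imp_continuous_on)
  define \<gamma> where "\<gamma> x = \<phi> x * scale_density X x" for x
  have c\<gamma>: "continuous_on (state_interval X) \<gamma>"
    unfolding \<gamma>_def[abs_def] by (intro continuous_intros c\<phi> dens)
  show thesis
  proof
    fix x assume x: "x \<in> state_interval X"
    then have \<sigma>: "(volatility X x)\<^sup>2 \<noteq> 0"
      using X by (auto simp: diffusion_coefficients_def)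
    show "oriented_scale_integral X C x (\<lambda>u. \<integral>\<^sup>+v\<in>{u..}. ennreal (k v) \<partial>speed_meas X) =
        ereal (LBINT u=ereal C..ereal x. \<gamma> u)"
      unfolding \<gamma>_def
      by (rule oriented_scale_integral_eq_LBINT[OF X C x c\<phi> \<phi>(2)]) (simp_all add: tail \<phi>(1))
    show "((\<lambda>x. LBINT u=ereal C..ereal x. \<gamma> u) has_real_derivative \<gamma> x) (at x)"
      by (rule LBINT_has_real_derivative[OF c\<gamma> C x])
    have "(\<gamma> has_real_derivative - q x * scale_density X x +
        - (2 * drift X x / (volatility X x)\<^sup>2) * scale_density X x * \<phi> x) (at x)"
      unfolding \<gamma>_def[abs_def]
      by (rule DERIV_mult[OF \<phi>(3)[OF x] scale_density_has_real_derivative[OF X x]])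
    also have "- q x * scale_density X x +
        - (2 * drift X x / (volatility X x)\<^sup>2) * scale_density X x * \<phi> x =
        (- k x - 2 * drift X x * \<gamma> x) / (volatility X x)\<^sup>2"
      using \<sigma> scale_density_pos[of X x]
      by (simp add: q_def \<gamma>_def speed_density_def field_simps)
    finally show "(\<gamma> has_real_derivative (- k x - 2 * drift X x * \<gamma> x) / (volatility X x)\<^sup>2) (at x)"
      by simp
    show "0 \<le> \<gamma> x"
      using \<phi>(2)[OF x] scale_density_pos[of X x] by (simp add: \<gamma>_def)
    assume kpos: "\<And>v. v \<in> state_interval X \<Longrightarrow> 0 < k v"
    have qpos: "0 < q v" if "v \<in> state_interval X" for v
      using kpos[OF that] X that scale_density_pos[of X v]
      by (simp add: q_def speed_density_def diffusion_coefficients_def)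
    \<comment> \<open>The tail is nonnegative at \<open>x + e\<close> and strictly decreasing on the
      way there from \<open>x\<close>, hence positive at \<open>x\<close>.\<close>
    obtain e where e: "0 < e" "cball x e \<subseteq> state_interval X"
      using x open_state_interval by (meson open_contains_cball)
    then have "x + e \<in> cball x e"
      by (simp add: dist_real_def)
    then have xe: "x + e \<in> state_interval X"
      using e by blast
    have "\<phi> (x + e) < \<phi> x"
    proof (rule DERIV_neg_imp_decreasing[of x "x + e" \<phi>])
      fix v assume "x \<le> v" "v \<le> x + e"
      then have "v \<in> state_interval X"
        using Icc_subset_state_interval[OF x xe] by auto
      then show "\<exists>y. (\<phi> has_real_derivative y) (at v) \<and> y < 0"
        using \<phi>(3) qpos by fastforce
    qed (use e in simp)
    then show "0 < \<gamma> x"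
      using \<phi>(2)[OF xe] scale_density_pos[of X x] by (simp add: \<gamma>_def)
  qed
qed

text \<open>
  Inf-compactness gives \<open>c\<^sub>0 > 1\<close> near the right end, so finiteness of \<open>\<integral> c\<^sub>0 dM\<close> bounds the
  speed measure there.
\<close>

lemma speed_meas_atLeast_finite:
  assumes X: "diffusion_coefficients X" and c0: "holding_cost_condition X c0"
    and u: "u \<in> state_interval X"
  shows "emeasure (speed_meas X) {u..} < \<infinity>"
proof -
  define K where "K = insert u {x \<in> state_interval X. c0 x \<le> 1}"
  have "compact K"
    using c0 by (auto simp: K_def holding_cost_condition_def)
  then obtain w where w: "w \<in> K" "\<And>x. x \<in> K \<Longrightarrow> x \<le> w"
    using compact_attains_sup[of K] by (auto simp: K_def)
  have wI: "w \<in> state_interval X" and uw: "u \<le> w"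
    using w u by (auto simp: K_def)
  have [measurable_cong]: "sets (speed_meas X) = sets borel"
    by (simp add: speed_meas_def)
  have c0c: "continuous_on (state_interval X) c0"
    using c0 by (simp add: holding_cost_condition_def)
  have I: "AE v in speed_meas X. v \<in> state_interval X"
    unfolding speed_meas_def by (intro AE_state_interval_density continuous_on_densities X)
  have meas: "(\<lambda>v. indicator (state_interval X) v * ennreal (c0 v)) \<in> borel_measurable borel"
    by (rule borel_measurable_state_interval_density[OF c0c])
  have "emeasure (speed_meas X) {u..} = (\<integral>\<^sup>+v. indicator {u..} v \<partial>speed_meas X)"
    by simp
  also have "\<dots> \<le> (\<integral>\<^sup>+v. indicator {u..w} v +
      indicator (state_interval X) v * ennreal (c0 v) * indicator {u..} v \<partial>speed_meas X)"
  proof (rule nn_integral_mono_AE)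
    show "AE v in speed_meas X. indicator {u..} v \<le> indicator {u..w} v +
      indicator (state_interval X) v * ennreal (c0 v) * indicator {u..} v"
      using I
    proof eventually_elim
      case (elim v)
      show ?case
      proof (cases "v \<in> K")
        case True
        then show ?thesis
          using w(2) by (auto simp: indicator_def)
      next
        case False
        then have "1 \<le> ennreal (c0 v)"
          using elim by (auto simp: K_def ennreal_1[symmetric] simp del: ennreal_1 intro!: ennreal_leI)
        then show ?thesis
          using elim by (auto simp: indicator_def add_increasing)
      qed
    qed
  qed
  also have "\<dots> = emeasure (speed_meas X) {u..w} +
      (\<integral>\<^sup>+v\<in>{u..}. indicator (state_interval X) v * ennreal (c0 v) \<partial>speed_meas X)"
    using meas by (subst nn_integral_add) auto
  also have "(\<integral>\<^sup>+v\<in>{u..}. indicator (state_interval X) v * ennreal (c0 v) \<partial>speed_meas X) =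
      (\<integral>\<^sup>+v\<in>{u..}. ennreal (c0 v) \<partial>speed_meas X)"
    using I by (intro nn_integral_cong_AE) (auto simp: indicator_def)
  also have "emeasure (speed_meas X) {u..w} + \<dots> < \<infinity>"
    using c0 u emeasure_speed_meas_Icc[OF X u wI uw]
    by (auto simp: holding_cost_condition_def ennreal_add_less_top)
  finally show ?thesis .
qed

section \<open>Monotonicity and values at the end points\<close>

lemma oriented_scale_integral_mono:
  assumes "x \<le> y"
  shows "oriented_scale_integral X C x f \<le> oriented_scale_integral X C y f"
proof -
  have *: "enn2ereal (\<integral>\<^sup>+u\<in>A. f u \<partial>scale_meas X) \<le> enn2ereal (\<integral>\<^sup>+u\<in>B. f u \<partial>scale_meas X)"
    if "A \<subseteq> B" for A B :: "real set"
    using that by (intro iffD1[OF less_eq_ennreal.rep_eq] nn_integral_mono) (auto simp: indicator_def)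
  \<comment> \<open>When \<open>x\<close> and \<open>y\<close> lie on different sides of
    \<open>C\<close>, a nonpositive value is compared with a nonnegative one.\<close>
  have "- enn2ereal s \<le> enn2ereal t" for s t
    by (meson enn2ereal_nonneg ereal_uminus_le_0_iff order_trans)
  then show ?thesis
    using assms by (auto simp: oriented_scale_integral_def intro!: *)
qed

lemma AE_scale_meas: "diffusion_coefficients X \<Longrightarrow> AE x in scale_meas X. x \<in> state_interval X"
  unfolding scale_meas_def by (intro AE_state_interval_density continuous_on_densities)

text \<open>The scale measure gives no mass to the points from \<open>b\<close> on, so the range up
  to \<open>b\<close> can be extended to the half-line in which the entrance and cost conditions are
  phrased.\<close>

lemma oriented_scale_integral_right_end:
  assumes X: "diffusion_coefficients X" and C: "C \<in> state_interval X" and b: "ereal b = right_end X"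
  shows "oriented_scale_integral X C b f = enn2ereal (\<integral>\<^sup>+u\<in>{C..}. f u \<partial>scale_meas X)"
proof -
  have "C \<le> b"
    using C by (simp add: state_interval_def einterval_iff b[symmetric])
  moreover have "(\<integral>\<^sup>+u\<in>{C..b}. f u \<partial>scale_meas X) = (\<integral>\<^sup>+u\<in>{C..}. f u \<partial>scale_meas X)"
    using AE_scale_meas[OF X]
    by (intro nn_integral_cong_AE)
      (auto simp: indicator_def state_interval_def einterval_iff b[symmetric])
  ultimately show ?thesis
    by (simp add: oriented_scale_integral_def)
qed

text \<open>The last clause of \<open>holding_cost_condition\<close> makes the double integral of
  \<open>c0\<close> diverge. Doubling the integrand preserves this because \<open>c0\<close> is
  nonnegative on the interval, which carries the speed measure.\<close>

lemma g0_right_end: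
  assumes X: "diffusion_coefficients X" and c0: "holding_cost_condition X c0"
    and C: "C \<in> state_interval X" and b: "ereal b = right_end X"
  shows "g0 X c0 C b = \<infinity>"
proof -
  have I: "AE v in speed_meas X. v \<in> state_interval X"
    unfolding speed_meas_def by (intro AE_state_interval_density continuous_on_densities X)
  have "(\<integral>\<^sup>+u\<in>{C..}. (\<integral>\<^sup>+v\<in>{u..}. ennreal (c0 v) \<partial>speed_meas X) \<partial>scale_meas X) \<le>
      (\<integral>\<^sup>+u\<in>{C..}. (\<integral>\<^sup>+v\<in>{u..}. ennreal (2 * c0 v) \<partial>speed_meas X) \<partial>scale_meas X)"
  proof (rule nn_integral_mono, rule mult_right_mono, rule nn_integral_mono_AE)
    show "AE v in speed_meas X. ennreal (c0 v) * indicator {u..} v \<le>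
        ennreal (2 * c0 v) * indicator {u..} v" for u
      using I
    proof eventually_elim
      case (elim v)
      then have "0 \<le> c0 v"
        using c0 by (auto simp: holding_cost_condition_def)
      then show ?case
        by (intro mult_right_mono ennreal_leI) auto
    qed
  qed auto
  then have "(\<integral>\<^sup>+u\<in>{C..}. (\<integral>\<^sup>+v\<in>{u..}. ennreal (2 * c0 v) \<partial>speed_meas X) \<partial>scale_meas X) = \<infinity>"
    using c0 C by (simp add: holding_cost_condition_def top_unique)
  then show ?thesis
    by (simp add: g0_def oriented_scale_integral_right_end[OF X C b])
qed

lemma zeta_right_end_finite:
  assumes X: "diffusion_coefficients X" and C: "C \<in> state_interval X"
    and b: "ereal b = right_end X" "right_entrance X"
  shows "\<bar>zeta X C b\<bar> \<noteq> \<infinity>"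
proof -
  have "(\<integral>\<^sup>+u\<in>{C..}. emeasure (speed_meas X) {u..} \<partial>scale_meas X) < \<infinity>"
    using b C by (auto simp: right_entrance_def)
  then show ?thesis
    unfolding zeta_def oriented_scale_integral_right_end[OF X C b(1)]
    by (cases "\<integral>\<^sup>+u\<in>{C..}. emeasure (speed_meas X) {u..} \<partial>scale_meas X" rule: ennreal_cases)
      (auto simp: enn2ereal_ennreal)
qed

text \<open>Superlevel sets of a decreasing function are intervals. This supplies the measurability
  of \<open>M[u, C]\<close> in \<open>u\<close>, by which an integral of a sum is split
  below.\<close>

lemma borel_measurable_antimono:
  fixes f :: "real \<Rightarrow> 'a :: {linorder_topology, second_countable_topology}"
  assumes "antimono f"
  shows "f \<in> borel_measurable borel"
proof (rule borel_measurableI_greater)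
  fix y
  have "is_interval {x. y < f x}"
    unfolding is_interval_1
  proof (intro ballI allI impI)
    fix a b x assume "b \<in> {x. y < f x}" "a \<le> x \<and> x \<le> b"
    then show "x \<in> {x. y < f x}"
      using antimonoD[OF assms, of x b] by simp
  qed
  then have "{x. y < f x} \<in> sets borel"
    by (rule real_interval_borel_measurable)
  then show "{x \<in> space borel. y < f x} \<in> sets borel"
    by simp
qed

text \<open>For \<open>u <= C\<close> the tail \<open>M[u, b)\<close> is at most
  \<open>M[u, C] + M[C, b)\<close>. Integrated over \<open>(a, C]\<close>, the first term is finite
  by attainability; the second is a finite constant times \<open>S(a, C]\<close>, which is finite
  because \<open>a\<close> is attracting.\<close>

lemma zeta_left_end_finite:
  assumes X: "diffusion_coefficients X" "left_attracting X" and c0: "holding_cost_condition X c0"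
    and C: "C \<in> state_interval X"
    and a: "ereal a = left_end X" "left_attainable X"
  shows "\<bar>zeta X C a\<bar> \<noteq> \<infinity>"
proof -
  have [measurable_cong]: "sets (scale_meas X) = sets borel" "sets (speed_meas X) = sets borel"
    by (simp_all add: scale_meas_def speed_meas_def)
  have [measurable]: "(\<lambda>u. emeasure (speed_meas X) {u..C}) \<in> borel_measurable borel"
    by (intro borel_measurable_antimono) (auto simp: monotone_def intro!: emeasure_mono)
  have "(\<integral>\<^sup>+u\<in>{a..C}. emeasure (speed_meas X) {u..} \<partial>scale_meas X) \<le>
      (\<integral>\<^sup>+u. emeasure (speed_meas X) {u..C} * indicator {..C} u +
        emeasure (speed_meas X) {C..} * indicator {..C} u \<partial>scale_meas X)"
  proof (rule nn_integral_mono)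
    fix u
    have "emeasure (speed_meas X) {u..} \<le>
        emeasure (speed_meas X) {u..C} + emeasure (speed_meas X) {C..}" if "u \<le> C"
    proof -
      have "{u..} = {u..C} \<union> {C..}"
        using that by auto
      then show ?thesis
        by (simp add: emeasure_subadditive)
    qed
    then show "emeasure (speed_meas X) {u..} * indicator {a..C} u \<le>
        emeasure (speed_meas X) {u..C} * indicator {..C} u +
        emeasure (speed_meas X) {C..} * indicator {..C} u"
      by (auto simp: indicator_def)
  qed
  also have "\<dots> = (\<integral>\<^sup>+u\<in>{..C}. emeasure (speed_meas X) {u..C} \<partial>scale_meas X) +
      emeasure (speed_meas X) {C..} * emeasure (scale_meas X) {..C}"
    by (subst nn_integral_add) (auto simp: nn_integral_cmult_indicator)
  also have "\<dots> < \<infinity>"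
    using a(2) X(2) C speed_meas_atLeast_finite[OF X(1) c0 C]
    by (auto simp: left_attainable_def left_attracting_def ennreal_add_less_top ennreal_mult_less_top)
  finally have fin: "(\<integral>\<^sup>+u\<in>{a..C}. emeasure (speed_meas X) {u..} \<partial>scale_meas X) < \<infinity>" .
  have "a < C"
    using C by (simp add: state_interval_def einterval_iff a(1)[symmetric])
  with fin show ?thesis
    unfolding zeta_def oriented_scale_integral_def
    by (cases "\<integral>\<^sup>+u\<in>{a..C}. emeasure (speed_meas X) {u..} \<partial>scale_meas X" rule: ennreal_cases)
      (auto simp: enn2ereal_ennreal)
qed


section \<open>Smoothness on the interval, finiteness and strict monotonicity of
  \<open>zeta\<close>\<close>

lemma state_space_cases:
  assumes "x \<in> state_space X"
  obtains "x \<in> state_interval X"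
  | "ereal x = left_end X" "left_attainable X"
  | "ereal x = right_end X" "right_entrance X"
  using assms by (auto simp: state_space_def)

lemma state_space_bounds:
  assumes X: "diffusion_coefficients X" and x: "x \<in> state_space X"
  shows "left_end X \<le> ereal x" "ereal x \<le> right_end X"
  using x assms unfolding diffusion_coefficients_def
  by (auto elim!: state_space_cases simp: state_interval_def einterval_iff less_imp_le)

lemma between_state_space:
  assumes "diffusion_coefficients X" and "y \<in> state_space X" "z \<in> state_space X" "y < x" "x < z"
  shows "x \<in> state_interval X"
  using state_space_bounds[OF assms(1,2)] state_space_bounds[OF assms(1,3)] assms(4,5)
  unfolding state_interval_def einterval_iff
  by (metis ereal_less_eq(3) le_less_trans less_eq_ereal_def less_ereal.simps(1) less_le_trans)

lemma state_interval_subset_state_space: "x \<in> state_interval X \<Longrightarrow> x \<in> state_space X"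
  by (simp add: state_space_def)

text \<open>Two applications of \<open>second_order_primitive\<close>, arranged so that the second
  derivatives express \<open>A g0 = - c0\<close> and \<open>A zeta = - 1\<close>. Since the
  integrand for \<open>zeta\<close> is a positive constant, its first derivative is strictly
  positive.\<close>

lemma g0_zeta_smooth:
  assumes X: "diffusion_coefficients X" and c0: "holding_cost_condition X c0"
    and C: "C \<in> state_interval X"
  obtains g g' z z' where
    "\<And>x. x \<in> state_interval X \<Longrightarrow> g0 X c0 C x = ereal (g x)"
    "\<And>x. x \<in> state_interval X \<Longrightarrow> zeta X C x = ereal (z x)"
    "\<And>x. x \<in> state_interval X \<Longrightarrow> (g has_real_derivative g' x) (at x)"
    "\<And>x. x \<in> state_interval X \<Longrightarrow> (z has_real_derivative z' x) (at x)"
    "\<And>x. x \<in> state_interval X \<Longrightarrow>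
      (g' has_real_derivative (- 2 * c0 x - 2 * drift X x * g' x) / (volatility X x)\<^sup>2) (at x)"
    "\<And>x. x \<in> state_interval X \<Longrightarrow>
      (z' has_real_derivative (- 2 - 2 * drift X x * z' x) / (volatility X x)\<^sup>2) (at x)"
    "\<And>x. x \<in> state_interval X \<Longrightarrow> 0 < z' x"
proof -
  have c0c: "continuous_on (state_interval X) c0"
    and c0nn: "\<And>x. x \<in> state_interval X \<Longrightarrow> 0 \<le> c0 x"
    using c0 by (auto simp: holding_cost_condition_def)
  have [measurable_cong]: "sets (speed_meas X) = sets borel"
    by (simp add: speed_meas_def)
  have I: "AE v in speed_meas X. v \<in> state_interval X"
    unfolding speed_meas_def by (intro AE_state_interval_density continuous_on_densities X)
  have "(\<integral>\<^sup>+v\<in>{C..}. ennreal (2 * c0 v) \<partial>speed_meas X) =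
      (\<integral>\<^sup>+v. 2 * (indicator (state_interval X) v * ennreal (c0 v) * indicator {C..} v) \<partial>speed_meas X)"
    using I c0nn by (intro nn_integral_cong_AE) (auto simp: indicator_def ennreal_mult)
  also have "\<dots> =
      2 * (\<integral>\<^sup>+v\<in>{C..}. indicator (state_interval X) v * ennreal (c0 v) \<partial>speed_meas X)"
    \<comment> \<open>The truncation of \<open>c0\<close> to the interval is Borel on the whole
      line, so the factor 2 can leave the integral.\<close>
    using borel_measurable_state_interval_density[OF c0c] by (intro nn_integral_cmult) auto
  also have "(\<integral>\<^sup>+v\<in>{C..}. indicator (state_interval X) v * ennreal (c0 v) \<partial>speed_meas X) =
      (\<integral>\<^sup>+v\<in>{C..}. ennreal (c0 v) \<partial>speed_meas X)"
    using I by (intro nn_integral_cong_AE) (auto simp: indicator_def)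
  also have "2 * \<dots> < \<infinity>"
    using c0 C by (auto simp: holding_cost_condition_def ennreal_mult_less_top)
  finally have fin: "(\<integral>\<^sup>+v\<in>{C..}. ennreal (2 * c0 v) \<partial>speed_meas X) < \<infinity>" .
  obtain g g' where g:
    "\<And>x. x \<in> state_interval X \<Longrightarrow> oriented_scale_integral X C x
      (\<lambda>u. \<integral>\<^sup>+v\<in>{u..}. ennreal (2 * c0 v) \<partial>speed_meas X) = ereal (g x)"
    "\<And>x. x \<in> state_interval X \<Longrightarrow> (g has_real_derivative g' x) (at x)"
    "\<And>x. x \<in> state_interval X \<Longrightarrow>
      (g' has_real_derivative (- (2 * c0 x) - 2 * drift X x * g' x) / (volatility X x)\<^sup>2) (at x)"
    by (rule second_order_primitive[OF X C _ _ fin]) (auto intro!: continuous_intros c0c c0nn)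
  have fin1: "(\<integral>\<^sup>+v\<in>{C..}. ennreal 1 \<partial>speed_meas X) < \<infinity>"
    using speed_meas_atLeast_finite[OF X c0 C] by simp
  obtain z z' where z:
    "\<And>x. x \<in> state_interval X \<Longrightarrow> oriented_scale_integral X C x
      (\<lambda>u. \<integral>\<^sup>+v\<in>{u..}. ennreal 1 \<partial>speed_meas X) = ereal (z x)"
    "\<And>x. x \<in> state_interval X \<Longrightarrow> (z has_real_derivative z' x) (at x)"
    "\<And>x. x \<in> state_interval X \<Longrightarrow>
      (z' has_real_derivative (- 1 - 2 * drift X x * z' x) / (volatility X x)\<^sup>2) (at x)"
    "\<And>x. x \<in> state_interval X \<Longrightarrow> 0 < z' x"
    by (rule second_order_primitive[OF X C _ _ fin1]) auto
  show thesis
  proof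
    fix x assume x: "x \<in> state_interval X"
    show "g0 X c0 C x = ereal (g x)" "zeta X C x = ereal (2 * z x)"
      using g(1)[OF x] z(1)[OF x] by (simp_all add: g0_def zeta_def)
    show "(g has_real_derivative g' x) (at x)"
      "(g' has_real_derivative (- 2 * c0 x - 2 * drift X x * g' x) / (volatility X x)\<^sup>2) (at x)"
      using g(2,3)[OF x] by simp_all
    show "((\<lambda>x. 2 * z x) has_real_derivative 2 * z' x) (at x)"
      using z(2)[OF x] by (auto intro!: derivative_eq_intros)
    show "((\<lambda>x. 2 * z' x) has_real_derivative
        (- 2 - 2 * drift X x * (2 * z' x)) / (volatility X x)\<^sup>2) (at x)"
      using z(3)[OF x] by (auto intro!: derivative_eq_intros simp: diff_divide_distrib)
    show "0 < 2 * z' x"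
      using z(4)[OF x] by simp
  qed
qed

lemma zeta_finite:
  assumes X: "diffusion_coefficients X" "diffusion_condition X" and c0: "holding_cost_condition X c0"
    and C: "C \<in> state_interval X" and x: "x \<in> state_space X"
  shows "\<bar>zeta X C x\<bar> \<noteq> \<infinity>"
  using x
proof (cases rule: state_space_cases)
  case 1
  then show ?thesis
    by (metis g0_zeta_smooth[OF X(1) c0 C] abs_ereal.simps(1) PInfty_neq_ereal(1))
next
  case 2
  then show ?thesis
    using zeta_left_end_finite[OF X(1) _ c0 C] X(2) by (simp add: diffusion_condition_def)
next
  case 3
  then show ?thesis
    using zeta_right_end_finite[OF X(1) C] by simp
qed

text \<open>At end points only weak monotonicity is available. Strictness comes from two interior
  points \<open>u < v\<close> between \<open>y\<close> and \<open>z\<close>, where the derivative is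
  positive.\<close>

lemma zeta_less:
  assumes X: "diffusion_coefficients X" and c0: "holding_cost_condition X c0"
    and C: "C \<in> state_interval X" and yz: "(y, z) \<in> order_pairs X"
  shows "zeta X C y < zeta X C z"
proof -
  have yz': "y \<in> state_space X" "z \<in> state_space X" "y < z"
    using yz by (auto simp: order_pairs_def)
  then obtain u where u: "y < u" "u < z"
    using dense by blast
  obtain v where v: "u < v" "v < z"
    using dense u(2) by blast
  have uI: "u \<in> state_interval X" "v \<in> state_interval X"
    using between_state_space[OF X yz'(1,2)] u v by auto
  obtain zr z' where zr:
    "\<And>x. x \<in> state_interval X \<Longrightarrow> zeta X C x = ereal (zr x)"
    "\<And>x. x \<in> state_interval X \<Longrightarrow> (zr has_real_derivative z' x) (at x)"
    "\<And>x. x \<in> state_interval X \<Longrightarrow> 0 < z' x"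
    by (rule g0_zeta_smooth[OF X c0 C]) blast
  have "zr u < zr v"
  proof (rule DERIV_pos_imp_increasing[OF v(1), of zr])
    fix x assume "u \<le> x" "x \<le> v"
    then have "x \<in> state_interval X"
      using Icc_subset_state_interval[OF uI] by auto
    then show "\<exists>y. (zr has_real_derivative y) (at x) \<and> 0 < y"
      using zr by blast
  qed
  then have "zeta X C u < zeta X C v"
    by (simp add: zr(1) uI)
  moreover have "zeta X C y \<le> zeta X C u" "zeta X C v \<le> zeta X C z"
    using u v unfolding zeta_def
    by (auto intro!: ereal_mult_left_mono oriented_scale_integral_mono)
  ultimately show ?thesis
    by order
qed

section \<open>The optimal cost and the potential derived from it\<close>

lemma ordering_cost_nonneg:
  assumes "ordering_cost_condition X c1" and p: "p \<in> weak_order_pairs X"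
  shows "0 \<le> c1 p"
proof -
  obtain k where "0 < k" "\<forall>p\<in>weak_order_pairs X. k \<le> c1 p"
    using assms(1) unfolding ordering_cost_condition_def by blast
  with p show ?thesis
    by force
qed

text \<open>Serves to exclude an optimal cost of minus infinity.\<close>

lemma cost_ratio_nonneg:
  assumes X: "diffusion_coefficients X" and c0: "holding_cost_condition X c0"
    and c1: "ordering_cost_condition X c1" and C: "C \<in> state_interval X"
    and yz: "(y, z) \<in> order_pairs X"
  shows "0 \<le> cost_ratio X c0 c1 C (y, z)"
proof -
  have "0 \<le> c1 (y, z)"
    using yz by (intro ordering_cost_nonneg[OF c1]) (auto simp: order_pairs_def weak_order_pairs_def)
  moreover have "g0 X c0 C y \<le> g0 X c0 C z"
    using yz unfolding g0_def by (intro oriented_scale_integral_mono) (auto simp: order_pairs_def)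
  \<comment> \<open>Infinite values are covered: in \<open>ereal\<close>, equal infinities subtract
    to plus infinity, so the increment stays nonnegative.\<close>
  then have "0 \<le> g0 X c0 C z - g0 X c0 C y"
    by (cases "g0 X c0 C z"; cases "g0 X c0 C y") auto
  moreover have "0 \<le> zeta X C z - zeta X C y"
    using zeta_less[OF X c0 C yz] by (cases "zeta X C z"; cases "zeta X C y") auto
  then have "0 \<le> inverse (zeta X C z - zeta X C y)"
    by (cases "zeta X C z - zeta X C y") auto
  ultimately show ?thesis
    unfolding cost_ratio_def jump_op_def by (auto simp: divide_ereal_def)
qed

text \<open>The lower bound is \<open>cost_ratio_nonneg\<close>. For the upper one a pair of
  interior points suffices: the numerator is finite there and the increment of \<open>zeta\<close>
  is positive.\<close>

lemma optimal_cost_finite: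
  assumes X: "diffusion_coefficients X" and c0: "holding_cost_condition X c0"
    and c1: "ordering_cost_condition X c1" and C: "C \<in> state_interval X"
  obtains f where "optimal_cost X c0 c1 C = ereal f"
proof -
  obtain e where e: "0 < e" "cball C e \<subseteq> state_interval X"
    using C open_state_interval by (meson open_contains_cball)
  then have "C + e \<in> cball C e"
    by (simp add: dist_real_def)
  then have Ce: "C + e \<in> state_interval X"
    using e by blast
  then have yz: "(C, C + e) \<in> order_pairs X"
    using C e by (simp add: order_pairs_def state_interval_subset_state_space)
  obtain g z where gz: "\<And>x. x \<in> state_interval X \<Longrightarrow> g0 X c0 C x = ereal (g x)"
    "\<And>x. x \<in> state_interval X \<Longrightarrow> zeta X C x = ereal (z x)"
    by (rule g0_zeta_smooth[OF X c0 C]) blast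
  have "z C < z (C + e)"
    using zeta_less[OF X c0 C yz] by (simp add: gz C Ce)
  then have "cost_ratio X c0 c1 C (C, C + e) < \<infinity>"
    by (simp add: cost_ratio_def jump_op_def gz C Ce)
  then have "optimal_cost X c0 c1 C < \<infinity>"
    unfolding optimal_cost_def using yz by (meson INF_lower le_less_trans)
  moreover have "0 \<le> optimal_cost X c0 c1 C"
    unfolding optimal_cost_def using cost_ratio_nonneg[OF assms]
    by (intro INF_greatest) auto
  ultimately show thesis
    using that by (cases "optimal_cost X c0 c1 C") auto
qed

text \<open>Multiplying \<open>F* <= F(y, z)\<close> by the positive increment of
  \<open>zeta\<close> removes the quotient and leaves an inequality for the increments of
  \<open>h\<close>, sharp at the optimal pair. Since \<open>F*\<close> is finite, an optimal pair
  cannot have an infinite increment of \<open>g0\<close>; this places \<open>zs\<close> in the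
  interval and makes \<open>g0\<close> finite at \<open>ys\<close>, even if \<open>ys\<close> is the
  left end.\<close>

lemma optimal_cost_potential:
  assumes X: "diffusion_coefficients X" "diffusion_condition X" and c0: "holding_cost_condition X c0"
    and c1: "ordering_cost_condition X c1" and C: "C \<in> state_interval X"
    and opt: "(ys, zs) \<in> order_pairs X" "cost_ratio X c0 c1 C (ys, zs) = optimal_cost X c0 c1 C"
  obtains f h h' where
    "optimal_cost X c0 c1 C = ereal f"
    "zs \<in> state_interval X"
    "\<And>x. x \<in> insert ys (state_interval X) \<Longrightarrow>
      g0 X c0 C x - optimal_cost X c0 c1 C * zeta X C x = ereal (h x)"
    "\<And>r. ereal r + g0 X c0 C zs - optimal_cost X c0 c1 C * zeta X C zs = ereal (r + h zs)"
    "\<And>x. x \<in> state_space X \<Longrightarrow> ereal x = right_end X \<Longrightarrow>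
      g0 X c0 C x - optimal_cost X c0 c1 C * zeta X C x = \<infinity>"
    "h ys - h zs = c1 (ys, zs)"
    "\<And>y z. (y, z) \<in> order_pairs X \<Longrightarrow> y \<in> insert ys (state_interval X) \<Longrightarrow>
      z \<in> state_interval X \<Longrightarrow> h y - h z \<le> c1 (y, z)"
    "\<And>x. x \<in> state_interval X \<Longrightarrow> (h has_real_derivative h' x) (at x)"
    "\<And>x. x \<in> state_interval X \<Longrightarrow>
      (h' has_real_derivative 2 * (f - c0 x - drift X x * h' x) / (volatility X x)\<^sup>2) (at x)"
proof -
  obtain f where f: "optimal_cost X c0 c1 C = ereal f"
    by (rule optimal_cost_finite[OF X(1) c0 c1 C])
  \<comment> \<open>Infinite values become 0 under \<open>real_of_ereal\<close>, so
    \<open>\<gamma>\<close> and \<open>h\<close> carry meaning only where \<open>g0\<close> is shown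
    to be finite, namely on the interval and at \<open>ys\<close>.\<close>
  define \<gamma> \<zeta> where "\<gamma> x = real_of_ereal (g0 X c0 C x)" and "\<zeta> x = real_of_ereal (zeta X C x)" for x
  define h where "h x = \<gamma> x - f * \<zeta> x" for x
  obtain g g' z z' where gz:
    "\<And>x. x \<in> state_interval X \<Longrightarrow> g0 X c0 C x = ereal (g x)"
    "\<And>x. x \<in> state_interval X \<Longrightarrow> zeta X C x = ereal (z x)"
    "\<And>x. x \<in> state_interval X \<Longrightarrow> (g has_real_derivative g' x) (at x)"
    "\<And>x. x \<in> state_interval X \<Longrightarrow> (z has_real_derivative z' x) (at x)"
    "\<And>x. x \<in> state_interval X \<Longrightarrow>
      (g' has_real_derivative (- 2 * c0 x - 2 * drift X x * g' x) / (volatility X x)\<^sup>2) (at x)"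
    "\<And>x. x \<in> state_interval X \<Longrightarrow>
      (z' has_real_derivative (- 2 - 2 * drift X x * z' x) / (volatility X x)\<^sup>2) (at x)"
    by (rule g0_zeta_smooth[OF X(1) c0 C]) blast
  have mem: "ys \<in> state_space X" "zs \<in> state_space X" "ys < zs"
    using opt by (auto simp: order_pairs_def)
  have \<zeta>: "zeta X C x = ereal (\<zeta> x)" if "x \<in> state_space X" for x
    using zeta_finite[OF X c0 C that] by (simp add: \<zeta>_def ereal_real)
  have \<zeta>_less: "\<zeta> y < \<zeta> z" if "(y, z) \<in> order_pairs X" for y z
  proof -
    have "y \<in> state_space X" "z \<in> state_space X"
      using that by (auto simp: order_pairs_def)
    then show ?thesis
      using zeta_less[OF X(1) c0 C that] by (simp add: \<zeta>)
  qed
  have ratio_inf: "cost_ratio X c0 c1 C (y, z) = \<infinity>"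
    if "(y, z) \<in> order_pairs X" "g0 X c0 C z - g0 X c0 C y = \<infinity>" for y z
  proof -
    have "y \<in> state_space X" "z \<in> state_space X"
      using that by (auto simp: order_pairs_def)
    then show ?thesis
      using \<zeta>_less[OF that(1)] that(2) by (simp add: cost_ratio_def jump_op_def \<zeta> divide_ereal_def)
  qed
  have zs: "zs \<in> state_interval X"
    using mem(2)
  proof (cases rule: state_space_cases)
    case 2
    then show ?thesis
      using state_space_bounds(1)[OF X(1) mem(1)] mem(3) by (simp flip: 2(1))
  next
    case 3
    have "g0 X c0 C zs = \<infinity>"
      by (rule g0_right_end[OF X(1) c0 C 3(1)])
    then show ?thesis
      using ratio_inf[OF opt(1)] opt(2) f by simp
  qed
  \<comment> \<open>Monotonicity bounds \<open>g0\<close> at \<open>ys\<close> by its finite value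
    at \<open>zs\<close>; minus infinity at \<open>ys\<close> would make the optimal ratio
    infinite.\<close>
  have ys_fin: "\<bar>g0 X c0 C ys\<bar> \<noteq> \<infinity>"
  proof -
    have "g0 X c0 C ys \<le> g0 X c0 C zs"
      unfolding g0_def using mem by (intro oriented_scale_integral_mono) simp
    moreover have "g0 X c0 C ys \<noteq> - \<infinity>"
      using ratio_inf[OF opt(1)] opt(2) f by (auto simp: gz(1)[OF zs])
    ultimately show ?thesis
      by (cases "g0 X c0 C ys") (auto simp: gz(1)[OF zs])
  qed
  have \<gamma>: "g0 X c0 C x = ereal (\<gamma> x)" if "x \<in> insert ys (state_interval X)" for x
    using that ys_fin gz(1) by (auto simp: \<gamma>_def ereal_real)
  have space: "x \<in> state_space X" if "x \<in> insert ys (state_interval X)" for x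
    using that mem by (auto simp: state_interval_subset_state_space)
  have ratio: "cost_ratio X c0 c1 C (y, z) = ereal ((c1 (y, z) + (\<gamma> z - \<gamma> y)) / (\<zeta> z - \<zeta> y))"
    if "(y, z) \<in> order_pairs X" "y \<in> insert ys (state_interval X)" "z \<in> state_interval X" for y z
    using \<zeta>_less[OF that(1)] that
    by (simp add: cost_ratio_def jump_op_def \<gamma> \<zeta> space)
  have h_eq: "h x = g x - f * z x" if "x \<in> state_interval X" for x
    using that by (simp add: h_def \<gamma>_def \<zeta>_def gz)
  show thesis
  proof
    show "optimal_cost X c0 c1 C = ereal f" "zs \<in> state_interval X"
      by fact+
    show "g0 X c0 C x - optimal_cost X c0 c1 C * zeta X C x = ereal (h x)"
      if "x \<in> insert ys (state_interval X)" for x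
      using \<gamma>[OF that] \<zeta>[OF space[OF that]] by (simp add: f h_def)
    show "ereal r + g0 X c0 C zs - optimal_cost X c0 c1 C * zeta X C zs = ereal (r + h zs)" for r
      using zs by (simp add: gz f h_eq)
    show "g0 X c0 C x - optimal_cost X c0 c1 C * zeta X C x = \<infinity>"
      if "x \<in> state_space X" "ereal x = right_end X" for x
      using that g0_right_end[OF X(1) c0 C that(2)] by (simp add: \<zeta> f)
    have "f * (\<zeta> zs - \<zeta> ys) = c1 (ys, zs) + (\<gamma> zs - \<gamma> ys)"
      using ratio[OF opt(1) _ zs] \<zeta>_less[OF opt(1)] opt(2) f by (simp add: field_simps)
    then show "h ys - h zs = c1 (ys, zs)"
      by (simp add: h_def algebra_simps)
    show "h y - h z \<le> c1 (y, z)"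
      if "(y, z) \<in> order_pairs X" "y \<in> insert ys (state_interval X)" "z \<in> state_interval X" for y z
    proof -
      have "ereal f \<le> cost_ratio X c0 c1 C (y, z)"
        unfolding f[symmetric] optimal_cost_def by (rule INF_lower[OF that(1)])
      then have "f * (\<zeta> z - \<zeta> y) \<le> c1 (y, z) + (\<gamma> z - \<gamma> y)"
        using \<zeta>_less[OF that(1)] by (simp add: ratio[OF that] field_simps)
      then show ?thesis
        by (simp add: h_def algebra_simps)
    qed
    fix x assume x: "x \<in> state_interval X"
    have "((\<lambda>x. g x - f * z x) has_real_derivative g' x - f * z' x) (at x)"
      using gz(3,4)[OF x] by (auto intro!: derivative_eq_intros)
    then show "(h has_real_derivative g' x - f * z' x) (at x)"
      by (rule has_field_derivative_transform_within_open[OF _ open_state_interval x])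
        (simp add: h_eq)
    show "((\<lambda>x. g' x - f * z' x) has_real_derivative
        2 * (f - c0 x - drift X x * (g' x - f * z' x)) / (volatility X x)\<^sup>2) (at x)"
      using gz(5,6)[OF x]
      by (auto intro!: derivative_eq_intros simp: algebra_simps add_divide_distrib diff_divide_distrib)
  qed
qed

section \<open>Derivatives, gluing, and the modularity of \<open>c1\<close> up to the
  boundary\<close>

lemma C1_on_realI:
  fixes f f' :: "real \<Rightarrow> real"
  assumes "\<And>x. x \<in> D \<Longrightarrow> (f has_real_derivative f' x) (at x within D)" and "continuous_on D f'"
  shows "C1_on D f"
  unfolding C1_on_def
proof (intro exI conjI ballI)
  show "(f has_derivative blinfun_apply (blinfun_scaleR_left (f' x))) (at x within D)" if "x \<in> D" for x
    using assms(1)[OF that] unfolding has_field_derivative_def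
    by (rule back_subst[where P = "\<lambda>f'. (f has_derivative f') (at x within D)"]) (auto simp: fun_eq_iff)
  show "continuous_on D (\<lambda>x. blinfun_scaleR_left (f' x))"
    by (intro continuous_intros assms)
qed

lemma C1_on_realE:
  fixes f :: "real \<Rightarrow> real"
  assumes "C1_on D f"
  obtains f' where "\<And>x. x \<in> D \<Longrightarrow> (f has_real_derivative f' x) (at x within D)" "continuous_on D f'"
proof -
  from assms obtain f' where f': "\<And>x. x \<in> D \<Longrightarrow> (f has_derivative blinfun_apply (f' x)) (at x within D)"
      "continuous_on D f'"
    by (auto simp: C1_on_def)
  show thesis
  proof
    show "(f has_real_derivative blinfun_apply (f' x) 1) (at x within D)" if "x \<in> D" for x
    proof -
      \<comment> \<open>A linear map on the reals is multiplication by its value at 1, which serves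
        as the scalar derivative.\<close>
      have "blinfun_apply (f' x) h = blinfun_apply (f' x) 1 * h" for h
        using blinfun.scaleR_right[of "f' x" h 1] by (simp add: mult.commute)
      then have "blinfun_apply (f' x) = (*) (blinfun_apply (f' x) 1)"
        by (rule ext)
      then show ?thesis
        using f'(1)[OF that] unfolding has_field_derivative_def by metis
    qed
    show "continuous_on D (\<lambda>x. blinfun_apply (f' x) 1)"
      by (intro continuous_intros f')
  qed
qed

text \<open>Away from \<open>c\<close> the function agrees locally with one piece. At
  \<open>c\<close> both pieces have derivative \<open>d\<close> within closed half-lines that cover
  the line, and the two limits combine.\<close>

lemma has_real_derivative_If_le:
  fixes f g :: "real \<Rightarrow> real"
  assumes f: "x \<le> c \<Longrightarrow> (f has_real_derivative d) (at x)"
    and g: "c \<le> x \<Longrightarrow> (g has_real_derivative d) (at x)"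
    and eq: "x = c \<Longrightarrow> f c = g c"
  shows "((\<lambda>x. if x \<le> c then f x else g x) has_real_derivative d) (at x)"
proof -
  consider "x < c" | "x > c" | "x = c"
    by linarith
  then show ?thesis
  proof cases
    case 1
    then show ?thesis
      using has_field_derivative_transform_within_open[OF f, of "{..<c}"] by simp
  next
    case 2
    then show ?thesis
      using has_field_derivative_transform_within_open[OF g, of "{c<..}"] by simp
  next
    case 3
    let ?F = "\<lambda>x. if x \<le> c then f x else g x"
    have "(f has_real_derivative d) (at c within {..c})"
      "(g has_real_derivative d) (at c within {c..})"
      using f g 3 by (auto intro: has_field_derivative_at_within)
    \<comment> \<open>In this rule \<open>d\<close> is the radius of agreement, not the derivative;
      any positive number works because the functions agree on the whole half-line.\<close>
    note this[THEN has_field_derivative_transform_within[where d = 1 and g = ?F]]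
    from this(1) this(2) have "(?F has_real_derivative d) (at c within {..c})"
      "(?F has_real_derivative d) (at c within {c..})"
      using eq 3 by simp_all
    then have "(?F has_real_derivative d) (at c within {..c} \<union> {c..})"
      unfolding has_field_derivative_iff by (rule Lim_Un)
    moreover have "{..c} \<union> {c..} = UNIV"
      by auto
    ultimately show ?thesis
      by (simp add: 3)
  qed
qed

text \<open>Differentiability of \<open>f'\<close> is assumed at \<open>c\<close> only. If
  \<open>d < 0\<close>, then \<open>f'\<close>, which vanishes at \<open>c\<close>, is negative just
  to the right, and the mean value theorem produces a value below \<open>f c\<close>.\<close>

lemma second_derivative_test_min:
  fixes f f' :: "real \<Rightarrow> real"
  assumes e: "0 < e"
    and f: "\<And>x. \<bar>x - c\<bar> < e \<Longrightarrow> (f has_real_derivative f' x) (at x)"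
    and f': "(f' has_real_derivative d) (at c)"
    and min: "\<And>x. \<bar>x - c\<bar> < e \<Longrightarrow> f c \<le> f x"
  shows "f' c = 0" "0 \<le> d"
proof -
  show 0: "f' c = 0"
    using DERIV_local_min[OF f e] min e by (simp add: abs_minus_commute)
  show "0 \<le> d"
  proof (rule ccontr)
    assume "\<not> 0 \<le> d"
    then obtain r where r: "0 < r" "\<And>t. 0 < t \<Longrightarrow> t < r \<Longrightarrow> f' (c + t) < 0"
      using DERIV_neg_dec_right[OF f'] 0 by auto
    define t where "t = min r e / 2"
    have t: "0 < t" "t < r" "t < e"
      using r(1) e by (auto simp: t_def min_def)
    obtain u where u: "c < u" "u < c + t" "f (c + t) - f c = t * f' u"
      using MVT2[of c "c + t" f f'] t f by fastforce
    have "f' u < 0"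
      using r(2)[of "u - c"] u t by simp
    then have "f (c + t) < f c"
      using u(3) t(1) mult_pos_neg[of t "f' u"] by linarith
    then show False
      using min[of "c + t"] t by simp
  qed
qed

text \<open>The value \<open>deriv (deriv f) x\<close> depends on \<open>deriv f\<close> near
  \<open>x\<close>. Hence the first derivative is prescribed on an open set, the second at
  \<open>x\<close> alone.\<close>

lemma generator_eqI:
  assumes "open S" "x \<in> S"
    and f: "\<And>y. y \<in> S \<Longrightarrow> (f has_real_derivative f' y) (at y)"
    and f': "(f' has_real_derivative d) (at x)"
  shows "generator X f x = (volatility X x)\<^sup>2 / 2 * d + drift X x * f' x"
proof -
  have "(deriv f has_real_derivative d) (at x)"
    using f' assms(1,2)
    by (rule has_field_derivative_transform_within_open) (simp add: DERIV_imp_deriv[OF f])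
  then show ?thesis
    using DERIV_imp_deriv[OF f[OF assms(2)]] by (simp add: generator_def DERIV_imp_deriv)
qed

text \<open>The identity is assumed for interior points. Continuity of \<open>c1\<close> carries it
  to a first argument at the left end, by letting interior points \<open>v\<close> decrease to
  \<open>w\<close>.\<close>

lemma ordering_cost_quadrangle:
  assumes X: "diffusion_coefficients X" and c1: "ordering_cost_condition X c1"
    and w: "w \<in> state_space X"
    and I: "x \<in> state_interval X" "y \<in> state_interval X" "z \<in> state_interval X"
    and le: "w \<le> x" "x \<le> y" "y \<le> z"
  shows "c1 (w, z) + c1 (x, y) = c1 (w, y) + c1 (x, z)"
proof (cases "w \<in> state_interval X")
  case True
  then show ?thesis
    using c1 I le unfolding ordering_cost_condition_def by blast
next
  case False
  then have "w < x"
    using I le by (cases "w = x") auto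
  have WP: "continuous_on (weak_order_pairs X) c1"
    using c1 by (simp add: ordering_cost_condition_def)
  have ev: "eventually (\<lambda>v. v \<in> {w<..<x}) (at_right w)"
    using \<open>w < x\<close> by (rule eventually_at_right_real)
  then have evI: "eventually (\<lambda>v. v \<in> state_interval X \<and> v \<le> x) (at_right w)"
    by eventually_elim
      (use between_state_space[OF X w] I in \<open>auto intro: state_interval_subset_state_space\<close>)
  have lim: "((\<lambda>v. c1 (v, u)) \<longlongrightarrow> c1 (w, u)) (at_right w)" if u: "u \<in> state_interval X" "x \<le> u" for u
  proof (rule continuous_on_tendsto_compose[OF WP])
    show "((\<lambda>v. (v, u)) \<longlongrightarrow> (w, u)) (at_right w)"
      by (intro tendsto_intros)
    show "(w, u) \<in> weak_order_pairs X"
      using u w le by (auto simp: weak_order_pairs_def state_interval_subset_state_space)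
    show "eventually (\<lambda>v. (v, u) \<in> weak_order_pairs X) (at_right w)"
      using evI by eventually_elim
        (use u in \<open>auto simp: weak_order_pairs_def state_interval_subset_state_space\<close>)
  qed
  have "((\<lambda>v. c1 (v, z) + c1 (x, y)) \<longlongrightarrow> c1 (w, z) + c1 (x, y)) (at_right w)"
    using le I by (intro tendsto_intros lim) auto
  moreover have "((\<lambda>v. c1 (v, y) + c1 (x, z)) \<longlongrightarrow> c1 (w, y) + c1 (x, z)) (at_right w)"
    using le I by (intro tendsto_intros lim) auto
  moreover have "eventually (\<lambda>v. c1 (v, z) + c1 (x, y) = c1 (v, y) + c1 (x, z)) (at_right w)"
    using evI by eventually_elim
      (use c1 I le in \<open>auto simp: ordering_cost_condition_def\<close>)
  ultimately show ?thesis
    by (intro tendsto_unique[OF trivial_limit_at_right_real[of w]]) (auto simp: tendsto_cong)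
qed


text \<open>First derivatives agree at \<open>c\<close>; second derivatives may jump there, so
  \<open>c\<close> is removed for \<open>C2_on\<close>. Matching is requested only if
  \<open>c\<close> lies in \<open>S\<close>, which leaves room for \<open>c\<close> to be the left
  end with an empty left piece.\<close>

lemma piecewise_C1_C2:
  fixes F f g :: "real \<Rightarrow> real"
  assumes S: "open S"
    and F: "\<And>x. x \<in> S \<Longrightarrow> F x = (if x \<le> c then f x else g x)"
    and f: "\<And>x. x \<in> S \<Longrightarrow> x \<le> c \<Longrightarrow> (f has_real_derivative f' x) (at x)"
      "\<And>x. x \<in> S \<Longrightarrow> x \<le> c \<Longrightarrow> (f' has_real_derivative f'' x) (at x)"
      "continuous_on {x \<in> S. x \<le> c} f''"
    and g: "\<And>x. x \<in> S \<Longrightarrow> c \<le> x \<Longrightarrow> (g has_real_derivative g' x) (at x)"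
      "\<And>x. x \<in> S \<Longrightarrow> c \<le> x \<Longrightarrow> (g' has_real_derivative g'' x) (at x)"
      "continuous_on {x \<in> S. c \<le> x} g''"
    and eq: "c \<in> S \<Longrightarrow> f c = g c" "c \<in> S \<Longrightarrow> f' c = g' c"
  shows "C1_on S F" "C2_on (S - {c}) F"
    and "\<And>x. x \<in> S - {c} \<Longrightarrow> generator X F x =
      (volatility X x)\<^sup>2 / 2 * (if x \<le> c then f'' x else g'' x) +
      drift X x * (if x \<le> c then f' x else g' x)"
proof -
  let ?F' = "\<lambda>x. if x \<le> c then f' x else g' x" and ?F'' = "\<lambda>x. if x \<le> c then f'' x else g'' x"
  have F': "(F has_real_derivative ?F' x) (at x)" if x: "x \<in> S" for x
  proof -
    have "((\<lambda>x. if x \<le> c then f x else g x) has_real_derivative ?F' x) (at x)"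
      by (rule has_real_derivative_If_le) (use f(1)[OF x] g(1)[OF x] eq x in \<open>auto split: if_splits\<close>)
    then show ?thesis
      by (rule has_field_derivative_transform_within_open[OF _ S x]) (simp add: F)
  qed
  have F'': "(?F' has_real_derivative ?F'' x) (at x)" if x: "x \<in> S - {c}" for x
    by (rule has_real_derivative_If_le) (use f(2)[of x] g(2)[of x] eq x in \<open>auto split: if_splits\<close>)
  have "continuous_on {x \<in> S. x \<le> c} f'" "continuous_on {x \<in> S. c \<le> x} g'"
    using f(2) g(2) by (auto intro!: continuous_at_imp_continuous_on DERIV_isCont)
  then have contF': "continuous_on S ?F'"
    using eq(2) by (intro continuous_on_cases_le continuous_intros) auto
  then show "C1_on S F"
    by (intro C1_on_realI[where f' = ?F']) (rule has_field_derivative_at_within[OF F'])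
  have "continuous_on (S - {c}) ?F''"
    by (intro continuous_on_cases_le continuous_intros)
      (auto intro: continuous_on_subset[OF f(3)] continuous_on_subset[OF g(3)])
  then have "C1_on (S - {c}) ?F'"
    by (intro C1_on_realI[where f' = ?F'']) (rule has_field_derivative_at_within[OF F''])
  then show "C2_on (S - {c}) F"
    unfolding C2_on_def
    by (intro exI[of _ ?F'] conjI ballI has_field_derivative_at_within[OF F']) auto
  show "generator X F x = (volatility X x)\<^sup>2 / 2 * ?F'' x + drift X x * ?F' x" if "x \<in> S - {c}" for x
    by (rule generator_eqI[OF _ that F' F'']) (use S that in auto)
qed

text \<open>Derivatives within the domain become ordinary ones in its interior. For the map
  \<open>x\<close> to \<open>c1 (x, zs)\<close> the interval points up to \<open>ys\<close> are
  interior to the domain because \<open>ys < zs\<close>.\<close>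

lemma C2_on_interiorE:
  assumes "C2_on D f"
  obtains f' f'' where
    "\<And>x. x \<in> interior D \<Longrightarrow> (f has_real_derivative f' x) (at x)"
    "\<And>x. x \<in> interior D \<Longrightarrow> (f' has_real_derivative f'' x) (at x)"
    "continuous_on D f''"
proof -
  obtain f' where f': "\<And>x. x \<in> D \<Longrightarrow> (f has_real_derivative f' x) (at x within D)" "C1_on D f'"
    using assms by (auto simp: C2_on_def)
  obtain f'' where "\<And>x. x \<in> D \<Longrightarrow> (f' has_real_derivative f'' x) (at x within D)" "continuous_on D f''"
    using C1_on_realE[OF f'(2)] by blast
  with f'(1) that[of f' f''] show thesis
    using interior_subset[of D] by (auto simp: at_within_interior[symmetric] subset_iff)
qed

section \<open>Smooth fit at \<open>ys\<close> and the four relations for \<open>G\<close>\<close>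

theorem proposition3p9:
  fixes X :: diffusion
    and c0 :: "real \<Rightarrow> real"
    and c1 :: "real \<times> real \<Rightarrow> real"
    and C ys zs :: real
    and Fs :: ereal
    and G :: "real \<Rightarrow> ereal"
    and Gr :: "real \<Rightarrow> real"
  defines "Fs \<equiv> optimal_cost X c0 c1 C"
    and "G \<equiv> G_fun X c0 c1 C (ys, zs)"
    and "Gr \<equiv> (\<lambda>x. real_of_ereal (G x))"
  assumes "diffusion_coefficients X"
    and "diffusion_condition X"
    and "holding_cost_condition X c0"
    and "ordering_cost_condition X c1"
    and "C \<in> state_interval X"
    and "(ys, zs) \<in> order_pairs X"
    and "cost_ratio X c0 c1 C (ys, zs) = Fs"
    and "left_end X < ereal ys \<Longrightarrow>
           C1_on (order_pairs X) c1 \<and>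
           C2_on {x \<in> state_interval X. x \<le> zs} (\<lambda>x. c1 (x, zs)) \<and>
           antimono_on {x. left_end X < ereal x \<and> x < ys} (\<lambda>x. generator X Gr x + c0 x)"
  shows "(\<forall>x\<in>state_interval X. \<bar>G x\<bar> \<noteq> \<infinity>) \<and>
         C1_on (state_interval X) Gr \<and>
         C2_on (state_interval X - {ys}) Gr \<and>
         (\<forall>x\<in>state_interval X - {ys}. ereal (generator X Gr x + c0 x) - Fs \<ge> 0) \<and>
         (\<forall>(y, z)\<in>order_pairs X. jump_op G (y, z) \<ge> - ereal (c1 (y, z))) \<and>
         (\<forall>x\<in>state_interval X. x > ys \<longrightarrow> ereal (generator X Gr x + c0 x) - Fs = 0) \<and>
         (\<forall>x\<in>state_space X. x \<le> ys \<longrightarrow> jump_op G (x, zs) = - ereal (c1 (x, zs)))"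
proof -
  note X = assms(4,5) and c0 = assms(6) and c1 = assms(7) and C = assms(8)
  note opt = assms(9) assms(10)[unfolded Fs_def]
  let ?I = "state_interval X" and ?k = "\<lambda>x. c1 (x, zs)"
  obtain f h h' where f: "optimal_cost X c0 c1 C = ereal f"
    and zsI: "zs \<in> ?I"
    and right: "\<And>x. x \<in> insert ys ?I \<Longrightarrow>
      g0 X c0 C x - optimal_cost X c0 c1 C * zeta X C x = ereal (h x)"
    and left: "\<And>r. ereal r + g0 X c0 C zs - optimal_cost X c0 c1 C * zeta X C zs = ereal (r + h zs)"
    and right_end: "\<And>x. x \<in> state_space X \<Longrightarrow> ereal x = right_end X \<Longrightarrow>
      g0 X c0 C x - optimal_cost X c0 c1 C * zeta X C x = \<infinity>"
    and h_opt: "h ys - h zs = c1 (ys, zs)"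
    and h_le: "\<And>y z. (y, z) \<in> order_pairs X \<Longrightarrow> y \<in> insert ys ?I \<Longrightarrow> z \<in> ?I \<Longrightarrow> h y - h z \<le> c1 (y, z)"
    and h: "\<And>x. x \<in> ?I \<Longrightarrow> (h has_real_derivative h' x) (at x)"
      "\<And>x. x \<in> ?I \<Longrightarrow>
        (h' has_real_derivative 2 * (f - c0 x - drift X x * h' x) / (volatility X x)\<^sup>2) (at x)"
    by (rule optimal_cost_potential[OF X c0 c1 C opt]) blast
  have ys: "ys \<in> state_space X" "ys < zs"
    using opt by (auto simp: order_pairs_def)
  have vol: "(volatility X x)\<^sup>2 \<noteq> 0" if "x \<in> ?I" for x
    using X(1) that by (auto simp: diffusion_coefficients_def)
  have cont: "continuous_on ?I c0" "continuous_on ?I (drift X)" "continuous_on ?I (volatility X)"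
    using X(1) c0 by (auto simp: diffusion_coefficients_def holding_cost_condition_def)
  have h'_cont: "continuous_on ?I h'"
    using h(2) by (auto intro!: continuous_at_imp_continuous_on DERIV_isCont)
  have G_left: "G x = ereal (c1 (x, zs) + h zs)" if "x \<le> ys" for x
    using that by (simp add: G_def G_fun_def left)
  have G_right: "G x = ereal (h x)" if "ys < x" "x \<in> ?I" for x
    using that right by (simp add: G_def G_fun_def)
  have G_top: "G x = \<infinity>" if "ys < x" "x \<in> state_space X" "ereal x = right_end X" for x
    using that right_end by (simp add: G_def G_fun_def)
  have Gr: "Gr x = (if x \<le> ys then c1 (x, zs) + h zs else h x)" if "x \<in> ?I" for x
    using that by (simp add: Gr_def G_left G_right)
  \<comment> \<open>If an interval point lies at or left of \<open>ys\<close>, then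
    \<open>ys\<close> is itself interior. So when \<open>ys\<close> is the left end, the left piece
    of \<open>G\<close> is empty on the interval.\<close>
  have left_of: "ys \<in> ?I \<and> left_end X < ereal ys" if "x \<in> ?I" "x \<le> ys" for x
  proof -
    have "left_end X < ereal x"
      using that by (simp add: state_interval_def einterval_iff)
    moreover have "ys \<in> {x..zs}"
      using that ys by simp
    ultimately show ?thesis
      using Icc_subset_state_interval[OF that(1) zsI] that(2) by (auto intro: less_le_trans)
  qed
  obtain k' k'' where
    k: "\<And>x. x \<in> ?I \<Longrightarrow> x \<le> ys \<Longrightarrow> (?k has_real_derivative k' x) (at x)"
      "\<And>x. x \<in> ?I \<Longrightarrow> x \<le> ys \<Longrightarrow> (k' has_real_derivative k'' x) (at x)"
      "continuous_on {x \<in> ?I. x \<le> ys} k''"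
    and fit: "ys \<in> ?I \<Longrightarrow> k' ys = h' ys"
    and gen_left: "\<And>x. x \<in> ?I \<Longrightarrow> x < ys \<Longrightarrow>
      f \<le> (volatility X x)\<^sup>2 / 2 * k'' x + drift X x * k' x + c0 x"
  proof (cases "left_end X < ereal ys")
    case False
    then have "\<not> (x \<in> ?I \<and> x \<le> ys)" for x
      using left_of by blast
    then have "{x \<in> ?I. x \<le> ys} = {}" and none: "\<And>x. x \<in> ?I \<Longrightarrow> \<not> x \<le> ys"
      by auto
    \<comment> \<open>With an empty left piece every requirement is vacuous, so zero functions serve
      as derivatives.\<close>
    with that[of "\<lambda>_. 0" "\<lambda>_. 0"] show thesis
      by (metis continuous_on_empty less_imp_le order_refl)
  next
    case True
    moreover have "ereal ys < ereal zs" "ereal zs < right_end X"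
      using ys(2) zsI by (simp_all add: state_interval_def einterval_iff)
    ultimately have ysI: "ys \<in> ?I"
      unfolding state_interval_def einterval_iff by (blast intro: less_trans)
    have D: "{x \<in> ?I. x < zs} \<subseteq> interior {x \<in> ?I. x \<le> zs}"
      using open_Int[OF open_state_interval[of X] open_lessThan[of zs]]
      by (intro interior_maximal) (auto simp: Int_def)
    obtain k' k'' where k:
      "\<And>x. x \<in> interior {x \<in> ?I. x \<le> zs} \<Longrightarrow> (?k has_real_derivative k' x) (at x)"
      "\<And>x. x \<in> interior {x \<in> ?I. x \<le> zs} \<Longrightarrow> (k' has_real_derivative k'' x) (at x)"
      "continuous_on {x \<in> ?I. x \<le> zs} k''"
      using assms(11)[OF True] by (auto elim!: C2_on_interiorE)
    have kD: "(?k has_real_derivative k' x) (at x)" "(k' has_real_derivative k'' x) (at x)"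
      if "x \<in> ?I" "x < zs" for x
      using k(1,2) D that by auto
    obtain e1 where e1: "0 < e1" "ball ys e1 \<subseteq> ?I"
      using ysI open_state_interval by (meson open_contains_ball)
    \<comment> \<open>Points within \<open>e\<close> of \<open>ys\<close> stay in the interval and
      left of \<open>zs\<close>, so the pairs \<open>(x, zs)\<close> are admissible and
      \<open>c1 (x, zs)\<close> has two-sided derivatives in \<open>x\<close>.\<close>
    define e where "e = min e1 (zs - ys)"
    have e: "0 < e" "\<And>x. \<bar>x - ys\<bar> < e \<Longrightarrow> x \<in> ?I \<and> x < zs"
      using e1 ys by (auto simp: e_def dist_real_def subset_iff abs_minus_commute)
    have d1: "((\<lambda>x. ?k x - h x) has_real_derivative k' x - h' x) (at x)" if "\<bar>x - ys\<bar> < e" for x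
      using e(2)[OF that] kD h by (intro DERIV_diff) auto
    have d2: "((\<lambda>x. k' x - h' x) has_real_derivative
        k'' ys - 2 * (f - c0 ys - drift X ys * h' ys) / (volatility X ys)\<^sup>2) (at ys)"
      using ysI ys kD h by (intro DERIV_diff) auto
    have le: "?k ys - h ys \<le> ?k x - h x" if "\<bar>x - ys\<bar> < e" for x
      using e(2)[OF that] h_le[of x zs] h_opt zsI
      by (simp add: order_pairs_def state_interval_subset_state_space)
    have min: "k' ys - h' ys = 0"
      "0 \<le> k'' ys - 2 * (f - c0 ys - drift X ys * h' ys) / (volatility X ys)\<^sup>2"
      by (rule second_derivative_test_min[OF e(1) d1 d2 le]; assumption)+
    \<comment> \<open>Left of \<open>ys\<close> this is \<open>A G + c0\<close>. Unlike the
      generator of \<open>Gr\<close>, it keeps the left piece beyond \<open>ys\<close> and is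
      therefore continuous at \<open>ys\<close>.\<close>
    let ?A = "\<lambda>x. (volatility X x)\<^sup>2 / 2 * k'' x + drift X x * k' x + c0 x"
    have "f \<le> ?A ys"
    proof -
      have "(volatility X ys)\<^sup>2 / 2 * (2 * (f - c0 ys - drift X ys * h' ys) / (volatility X ys)\<^sup>2)
          \<le> (volatility X ys)\<^sup>2 / 2 * k'' ys"
        using min(2) by (intro mult_left_mono) auto
      then show ?thesis
        using vol[OF ysI] min(1) by simp
    qed
    have gen: "generator X Gr x + c0 x = ?A x" if x: "x \<in> ?I" "x < ys" for x
    proof -
      have "(Gr has_real_derivative k' y) (at y)" if "y \<in> ?I \<inter> {..<ys}" for y
      proof -
        have "((\<lambda>x. ?k x + h zs) has_real_derivative k' y) (at y)"
          using kD(1)[of y] that ys by (auto intro!: derivative_eq_intros)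
        then show ?thesis
          by (rule has_field_derivative_transform_within_open[OF _ _ that])
            (auto simp: Gr open_state_interval)
      qed
      then show ?thesis
        using generator_eqI[of "?I \<inter> {..<ys}" x Gr k' "k'' x"] kD(2)[of x] x ys
        by (auto simp: open_state_interval open_Int)
    qed
    have "f \<le> ?A x" if x: "x \<in> ?I" "x < ys" for x
    proof -
      have "continuous_on {x \<in> ?I. x < zs} k'"
        using kD(2) by (auto intro!: continuous_at_imp_continuous_on DERIV_isCont)
      then have "continuous_on {x \<in> ?I. x < zs} ?A"
        by (intro continuous_intros continuous_on_subset[OF k(3)]
            cont[THEN continuous_on_subset]) auto
      moreover have "open {x \<in> ?I. x < zs}"
        using open_Int[OF open_state_interval[of X] open_lessThan[of zs]] by (simp add: Int_def)
      ultimately have "isCont ?A ys"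
        using ysI ys by (simp add: continuous_on_eq_continuous_at)
      then have lim: "(?A \<longlongrightarrow> ?A ys) (at_left ys)"
        by (simp add: isCont_def filterlim_at_split)
      \<comment> \<open>For \<open>t\<close> in \<open>(x, ys)\<close> the monotonicity hypothesis
        gives \<open>?A t <= ?A x\<close>; letting \<open>t\<close> tend to \<open>ys\<close>
        carries the bound at \<open>ys\<close> over to \<open>x\<close>.\<close>
      have "eventually (\<lambda>t. t \<in> {x<..<ys}) (at_left ys)"
        using x(2) by (rule eventually_at_left_real)
      then have "eventually (\<lambda>t. ?A t \<le> ?A x) (at_left ys)"
      proof eventually_elim
        case (elim t)
        then have t: "t \<in> ?I"
          using Icc_subset_state_interval[OF x(1) ysI] by auto
        then have "generator X Gr t + c0 t \<le> generator X Gr x + c0 x"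
          using assms(11)[OF True] x elim
          by (auto simp: monotone_on_def state_interval_def einterval_iff)
        then show ?case
          using gen[OF t] gen[OF x] elim by simp
      qed
      then have "?A ys \<le> ?A x"
        by (rule tendsto_upperbound[OF lim]) simp
      with \<open>f \<le> ?A ys\<close> show ?thesis
        by simp
    qed
    moreover have "continuous_on {x \<in> ?I. x \<le> ys} k''"
      using ys by (intro continuous_on_subset[OF k(3)]) auto
    ultimately show thesis
      using kD ys min(1) by (intro that[of k' k'']) auto
  qed
  define h'' where "h'' x = 2 * (f - c0 x - drift X x * h' x) / (volatility X x)\<^sup>2" for x
  have h''_cont: "continuous_on ?I h''"
    unfolding h''_def using vol by (intro continuous_intros cont h'_cont) auto
  have k_add: "((\<lambda>x. c1 (x, zs) + h zs) has_real_derivative k' x) (at x)"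
    if "x \<in> ?I" "x \<le> ys" for x
    using k(1)[OF that] by (auto intro!: derivative_eq_intros)
  have h''_cont_right: "continuous_on {x \<in> ?I. ys \<le> x} h''"
    by (rule continuous_on_subset[OF h''_cont]) auto
  have h2: "(h' has_real_derivative h'' x) (at x)" if "x \<in> ?I" for x
    using h(2)[OF that] by (simp add: h''_def)
  have fit0: "c1 (ys, zs) + h zs = h ys"
    using h_opt by simp
  note glue = piecewise_C1_C2[OF open_state_interval Gr k_add k(2,3) h(1) h2 h''_cont_right fit0 fit]
  have smooth: "C1_on ?I Gr" "C2_on (?I - {ys}) Gr"
    and gen: "\<And>x. x \<in> ?I - {ys} \<Longrightarrow> generator X Gr x =
      (volatility X x)\<^sup>2 / 2 * (if x \<le> ys then k'' x else h'' x) +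
      drift X x * (if x \<le> ys then k' x else h' x)"
    by (rule glue; assumption)+
  have gen_right: "generator X Gr x + c0 x = f" if "x \<in> ?I" "ys < x" for x
    using gen[of x] that vol[OF that(1)] by (simp add: h''_def) argo
  have jump: "- ereal (c1 (y, z)) \<le> G z - G y" if yz: "(y, z) \<in> order_pairs X" for y z
  proof -
    have mem: "y \<in> state_space X" "z \<in> state_space X" "y < z"
      using yz by (auto simp: order_pairs_def)
    have "ereal y < ereal z"
      using mem(3) by simp
    then have "left_end X < ereal z"
      using state_space_bounds(1)[OF X(1) mem(1)] by order
    then have z_cases: "z \<in> ?I \<or> ereal z = right_end X"
      using state_space_cases[OF mem(2)] by (metis less_irrefl)
    have y_right: "y \<in> ?I" if "ys < y"
      using between_state_space[OF X(1) ys(1) mem(2) that mem(3)] .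
    have Gy: "G y = (if y \<le> ys then ereal (c1 (y, zs) + h zs) else ereal (h y))"
      using G_left G_right y_right by auto
    show ?thesis
    proof (cases "z \<in> ?I")
      case False
      then have zb: "ereal z = right_end X"
        using z_cases by blast
      \<comment> \<open>The right end lies beyond \<open>zs\<close> and hence beyond
        \<open>ys\<close>, so \<open>G z\<close> is infinite while \<open>G y\<close> is
        real.\<close>
      have "zs < z"
        using zsI by (simp add: state_interval_def einterval_iff zb[symmetric])
      then have "G z = \<infinity>"
        using G_top mem(2) zb ys(2) by simp
      then show ?thesis
        by (simp add: Gy)
    next
      case zI: True
      show ?thesis
      proof (cases "z \<le> ys")
        case True
        \<comment> \<open>Modularity with both middle points equal to \<open>z\<close> turns
          \<open>G z - G y\<close> into \<open>c1 (z, z) - c1 (y, z)\<close>.\<close>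
        then have "c1 (y, zs) + c1 (z, z) = c1 (y, z) + c1 (z, zs)"
          using ordering_cost_quadrangle[OF X(1) c1 mem(1) zI zI zsI] mem(3) ys(2) by simp
        moreover have "0 \<le> c1 (z, z)"
          using mem by (intro ordering_cost_nonneg[OF c1]) (simp add: weak_order_pairs_def)
        ultimately show ?thesis
          using True mem(3) by (simp add: G_left)
      next
        case False
        then have Gz: "G z = ereal (h z)"
          using G_right zI by simp
        show ?thesis
        proof (cases "y < ys")
          case True
          have ysI: "ys \<in> ?I"
            using between_state_space[OF X(1) mem(1) _ True ys(2)] zsI
            by (simp add: state_interval_subset_state_space)
          \<comment> \<open>The difference between \<open>c1 (y, v)\<close> and
            \<open>c1 (ys, v)\<close> is the same for \<open>v = z\<close> and
            \<open>v = zs\<close>, whichever of the two is larger. This reduces the claim to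
            optimality at the pair \<open>(ys, z)\<close>.\<close>
          have "c1 (y, z) + c1 (ys, zs) = c1 (y, zs) + c1 (ys, z)"
            using ordering_cost_quadrangle[OF X(1) c1 mem(1) ysI zsI zI]
              ordering_cost_quadrangle[OF X(1) c1 mem(1) ysI zI zsI] True False ys(2)
            by (cases "z \<le> zs") auto
          moreover have "h ys - h z \<le> c1 (ys, z)"
            using h_le[of ys z] False ys(1) mem(2) zI by (simp add: order_pairs_def)
          ultimately show ?thesis
            using True h_opt by (simp add: Gz G_left)
        next
          case yys: False
          \<comment> \<open>For \<open>y = ys\<close> the left branch of \<open>G\<close> applies,
            and its value is again \<open>h ys\<close> by equality at the optimal pair.\<close>
          have "G y = ereal (h y)" "y \<in> insert ys ?I"
            using yys Gy h_opt y_right by (auto simp: not_less order_le_less)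
          then show ?thesis
            using h_le[OF yz _ zI] by (simp add: Gz)
        qed
      qed
    qed
  qed
  have "\<forall>x\<in>?I. \<bar>G x\<bar> \<noteq> \<infinity>"
  proof
    fix x assume "x \<in> ?I"
    then show "\<bar>G x\<bar> \<noteq> \<infinity>"
      by (cases "x \<le> ys") (simp_all add: G_left G_right)
  qed
  moreover have "0 \<le> ereal (generator X Gr x + c0 x) - Fs" if "x \<in> ?I - {ys}" for x
    using gen[OF that] gen_left[of x] gen_right[of x] that
    by (cases "x < ys") (auto simp: Fs_def f)
  moreover have "ereal (generator X Gr x + c0 x) - Fs = 0" if "x \<in> ?I" "ys < x" for x
    using gen_right[OF that] by (simp add: Fs_def f)
  moreover have "G zs - G x = - ereal (c1 (x, zs))" if "x \<le> ys" for x
    using G_left[OF that] G_right[OF ys(2) zsI] by simp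
  ultimately show ?thesis
    using smooth jump by (auto simp: jump_op_def)
qed

end
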